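(* Let $X=\mathcal H$ be a separable Hilbert space, let $\mu$ be a non-degenerate centred Gaussian probability measure on $X$ with Cameron--Martin space $(E,|\cdot|_E)$, let $\Phi\colon X\to\mathbb R$ be an admissible potential, and let $\mu^y$ be the corresponding posterior probability measure. Let $I\colon E\to\mathbb R$, $I(u)=\Phi(u)+\tfrac12|u|_E^2$, be the Onsager--Machlup functional. Then: (a) For every $\bar z\in X$ the following statements are equivalent: (i) $\bar z$ is an $X$-strong limit point, as $\delta\to0$, of some asymptotic maximizing family for $\mu^y$; (ii) $\bar z\in E$ and $\bar z$ minimizes the Onsager--Machlup functional $I$ over $E$; (iii) $\bar z$ is a MAP estimator for $\mu^y$. (b) There exists at least one MAP estimator for $\mu^y$.
   Context: $B_\delta(x)$ denotes the open ball of radius $\delta$ centred at $x$ in $(X,\|\cdot\|_X)$. A centred Gaussian measure $\mu$ on $X$ is non-degenerate if every nonzero continuous linear functional on $X$ has strictly positive variance under $\mu$. A function $\Phi\colon X\to\mathbb R$ is called an admissible potential if: (1) there is $M\in\mathbb R$ with $\Phi(u)\ge M$ for all $u\in X$; (2) for every $r>0$ there is $K(r)>0$ with $\Phi(u)\le K(r)$ for all $\|u\|_X<r$; (3) for every $r>0$ there is $L(r)>0$ with $|\Phi(u_1)-\Phi(u_2)|\le L(r)\|u_1-u_2\|_X$ whenever $\|u_1\|_X,\|u_2\|_X\le r$; and (normalization) $\Phi(0)=0$. The posterior $\mu^y$ is the probability measure on $X$ given by $\frac{d\mu^y}{d\mu}(u)=Z^{-1}\exp(-\Phi(u))$ with $Z=\int_X\exp(-\Phi(u))\,\mu(du)$.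 A MAP estimator for $\mu^y$ is a point $z\in X$ with $\lim_{\delta\searrow0}\frac{\mu^y(B_\delta(z))}{\sup_{x\in X}\mu^y(B_\delta(x))}=1$. A family $(\zeta^\delta)_{\delta>0}\subset X$ is an asymptotic maximizing family for $\mu^y$ if there is a family $(\varepsilon^\delta)_{\delta>0}$ in $(0,1)$ with $\varepsilon^\delta\to0$ as $\delta\searrow0$ such that $\frac{\mu^y(B_\delta(\zeta^\delta))}{\sup_{x\in X}\mu^y(B_\delta(x))}>1-\varepsilon^\delta$ for every $\delta>0$. $\bar z$ is an $X$-strong limit point of $(\zeta^\delta)_{\delta>0}$ as $\delta\to0$ if there is a sequence $\delta_n\searrow0$ with $\|\zeta^{\delta_n}-\bar z\|_X\to0$. *)

theory Defs
  imports "HOL-Probability.Probability"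
begin

definition centred_gaussian_law :: "real \<Rightarrow> real measure" where
  "centred_gaussian_law \<sigma> =
     (if \<sigma> = 0 then return borel 0 else density lborel (\<lambda>x. ennreal (normal_density 0 \<sigma> x)))"

definition centred_gaussian_measure :: "'a::real_normed_vector measure \<Rightarrow> bool" where
  "centred_gaussian_measure \<mu> \<longleftrightarrow>
     prob_space \<mu> \<and> sets \<mu> = sets borel \<and>
     (\<forall>l::'a \<Rightarrow> real. bounded_linear l \<longrightarrow> (\<exists>\<sigma>\<ge>0. distr \<mu> borel l = centred_gaussian_law \<sigma>))"

definition nondegenerate :: "'a::real_normed_vector measure \<Rightarrow> bool" where
  "nondegenerate \<mu> \<longleftrightarrow>
     (\<forall>l::'a \<Rightarrow> real. bounded_linear l \<and> l \<noteq> (\<lambda>x. 0) \<longrightarrow> prob_space.variance \<mu> l > 0)"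

text \<open>
  The Cameron-Martin space and norm of a Gaussian measure are taken as in Bogachev,
  \<^emph>\<open>Gaussian Measures\<close>, Section 2.2:
  the norm of \<open>h\<close> is the supremum of \<open>l h\<close> over all continuous linear functionals \<open>l\<close> of variance
  at most \<open>1\<close>, and the space consists of the \<open>h\<close> for which this supremum is finite.
  As \<open>Sup\<close> is the real-valued supremum, \<open>cm_norm \<mu> h\<close> is meaningful only for \<open>h \<in> cm_space \<mu>\<close>.
\<close>

definition cm_values :: "'a::real_normed_vector measure \<Rightarrow> 'a \<Rightarrow> real set" where
  "cm_values \<mu> h = {l h | l. bounded_linear l \<and> prob_space.variance \<mu> l \<le> 1}"

definition cm_space :: "'a::real_normed_vector measure \<Rightarrow> 'a set" where
  "cm_space \<mu> = {h. bdd_above (cm_values \<mu> h)}"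

definition cm_norm :: "'a::real_normed_vector measure \<Rightarrow> 'a \<Rightarrow> real" where
  "cm_norm \<mu> h = Sup (cm_values \<mu> h)"

definition admissible_potential :: "('a::real_normed_vector \<Rightarrow> real) \<Rightarrow> bool" where
  "admissible_potential \<Phi> \<longleftrightarrow>
     (\<exists>M. \<forall>u. \<Phi> u \<ge> M) \<and>
     (\<forall>r>0. \<exists>K>0. \<forall>u. norm u < r \<longrightarrow> \<Phi> u \<le> K) \<and>
     (\<forall>r>0. \<exists>L>0. \<forall>u1 u2. norm u1 \<le> r \<and> norm u2 \<le> r \<longrightarrow>
        \<bar>\<Phi> u1 - \<Phi> u2\<bar> \<le> L * norm (u1 - u2)) \<and>
     \<Phi> 0 = 0"

definition posterior :: "'a measure \<Rightarrow> ('a \<Rightarrow> real) \<Rightarrow> 'a measure" where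
  "posterior \<mu> \<Phi> =
     (let Z = (\<integral>u. exp (- \<Phi> u) \<partial>\<mu>) in density \<mu> (\<lambda>u. ennreal (inverse Z * exp (- \<Phi> u))))"

text \<open>The Onsager-Machlup functional; its domain is \<open>cm_space \<mu>\<close>, off which the value is arbitrary.\<close>

definition onsager_machlup :: "'a::real_normed_vector measure \<Rightarrow> ('a \<Rightarrow> real) \<Rightarrow> 'a \<Rightarrow> real" where
  "onsager_machlup \<mu> \<Phi> u = \<Phi> u + (cm_norm \<mu> u)\<^sup>2 / 2"

definition ball_ratio :: "'a::metric_space measure \<Rightarrow> real \<Rightarrow> 'a \<Rightarrow> real" where
  "ball_ratio \<nu> \<delta> z = measure \<nu> (ball z \<delta>) / (SUP x. measure \<nu> (ball x \<delta>))"

definition MAP_estimator :: "'a::metric_space measure \<Rightarrow> 'a \<Rightarrow> bool" where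
  "MAP_estimator \<nu> z \<longleftrightarrow> ((\<lambda>\<delta>. ball_ratio \<nu> \<delta> z) \<longlongrightarrow> 1) (at_right 0)"

text \<open>Families indexed by \<open>\<delta> > 0\<close> are functions on \<open>real\<close> whose values at \<open>\<delta> \<le> 0\<close> are ignored.\<close>

definition asymptotic_maximizing_family ::
    "'a::metric_space measure \<Rightarrow> (real \<Rightarrow> 'a) \<Rightarrow> bool" where
  "asymptotic_maximizing_family \<nu> \<zeta> \<longleftrightarrow>
     (\<exists>\<epsilon> :: real \<Rightarrow> real.
        (\<forall>\<delta>>0. 0 < \<epsilon> \<delta> \<and> \<epsilon> \<delta> < 1) \<and>
        (\<epsilon> \<longlongrightarrow> 0) (at_right 0) \<and>
        (\<forall>\<delta>>0. ball_ratio \<nu> \<delta> (\<zeta> \<delta>) > 1 - \<epsilon> \<delta>))"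

definition strong_limit_point :: "(real \<Rightarrow> 'a::real_normed_vector) \<Rightarrow> 'a \<Rightarrow> bool" where
  "strong_limit_point \<zeta> z \<longleftrightarrow>
     (\<exists>d :: nat \<Rightarrow> real. (\<forall>n. d n > 0) \<and> decseq d \<and> d \<longlonglongrightarrow> 0 \<and>
        (\<lambda>n. norm (\<zeta> (d n) - z)) \<longlonglongrightarrow> 0)"

end

(*
  The centred Gaussian measure is diagonalised: maximising the variance of u \<bullet> x over unit vectors u
  orthogonal to the vectors already chosen gives vectors v 0, v 1, ... that are orthogonal both in the
  Hilbert space and for the covariance. The maxima exist because the variance is weakly sequentially
  continuous, which for Gaussian laws is dominated convergence for cos (u \<bullet> x).

  In these coordinates the measure is a product of one-dimensional normal laws, and a ball is a
  decreasing limit of cylinders given by a bound on a sum of squares, so comparing one coordinate at a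
  time gives two inequalities for every radius d:
    mu (ball z d) \<le> exp (q u / 2 - u \<bullet> z + norm u * d) * mu (ball 0 d)   for all u, z
    mu (ball h d) \<ge> exp (- |h|^2 / 2) * mu (ball 0 d)   for h in the Cameron-Martin space,
  where q u is the variance of u \<bullet> x. Optimising over u, the first one yields the upper half of the
  Onsager-Machlup limit along any convergent sequence of centres. With u the tail of the centre, it
  shows that centres whose balls have mass comparable to that of the ball at 0 form a relatively
  compact sequence. Hence near-maximising centres accumulate, and every limit point minimises the
  Onsager-Machlup functional.
*)
theory Submission
  imports Defs
begin

section \<open>Hilbert space preliminaries\<close>

text \<open>All masses are measured against that of the ball at \<open>0\<close>; both inequalities
  compare with it and meet at \<open>weight u\<close>, a constant multiple of
  \<open>exp (- onsager_machlup \<mu> \<Phi> u)\<close>. They are used asymmetrically.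
  Near-maximising centres move with the radius and may a priori lie outside the Cameron-Martin
  space, so the upper bound holds at every centre, with a free \<open>u\<close> that is fixed before
  the limit and optimised after it. The lower bound is applied at fixed points of the Cameron-Martin
  space. The two agree because the supremum over \<open>u\<close> of
  \<open>u \<bullet> z - q u / 2\<close> is half the squared Cameron-Martin norm. The upper bound
  comes from the linear tilt \<open>exp (u \<bullet> x)\<close>: on the ball it is at least
  \<open>exp (u \<bullet> z - norm u * d)\<close>, while on each normal coordinate it acts as a
  shift, and an off-centre interval has at most the mass of the centred one. Tilt, norm and law must
  split over the same coordinates, hence the two orthogonalities of \<open>v\<close>. A minimiser is
  itself produced as a limit of near-maximising centres, and its MAP property follows by comparison
  with such a limit along supposedly bad radii.\<close>

lemma linear_le_quadratic_imp_zero: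
  fixes a b :: real
  assumes "\<And>t. t * a \<le> t\<^sup>2 * b"
  shows "a = 0"
proof (rule ccontr)
  assume "a \<noteq> 0"
  \<comment> \<open>\<open>c\<close> is positive and exceeds \<open>b\<close>, so
    \<open>t = a / c\<close> contradicts the assumption whatever the sign of
    \<open>b\<close>.\<close>
  define c where "c = \<bar>b\<bar> + 1"
  have c: "c > 0" by (simp add: c_def add_nonneg_pos)
  from assms[of "a / c"] have "a\<^sup>2 * c \<le> a\<^sup>2 * b"
    using c by (simp add: field_simps power2_eq_square)
  then have "c \<le> b" using \<open>a \<noteq> 0\<close> by simp
  then show False by (simp add: c_def abs_if split: if_splits)
qed

text \<open>The representer is the minimiser of \<open>J\<close>, and the representation is its
  first-order condition.\<close>

lemma riesz_representation:
  fixes f :: "'a::{real_inner, complete_space} \<Rightarrow> real"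
  assumes "bounded_linear f"
  obtains u where "f = (\<lambda>x. u \<bullet> x)"
proof -
  interpret bounded_linear f by fact
  obtain K where K: "\<And>x. norm (f x) \<le> norm x * K" using bounded by blast
  \<comment> \<open>For a representer \<open>u\<close> this would be \<open>norm (x - u)\<close>
    squared minus the constant \<open>norm u\<close> squared.\<close>
  define J where "J x = (norm x)\<^sup>2 - 2 * f x" for x
  have J_lower: "J x \<ge> - K\<^sup>2" for x
  proof -
    have "0 \<le> (norm x - K)\<^sup>2" by simp
    then have "2 * (norm x * K) \<le> (norm x)\<^sup>2 + K\<^sup>2" by (simp add: power2_diff)
    then show ?thesis using K[of x] by (simp add: J_def)
  qed
  define m where "m = (INF x. J x)"
  have bdd: "bdd_below (range J)" using J_lower by (auto intro!: bdd_belowI)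
  have m_le: "m \<le> J x" for x unfolding m_def by (intro cINF_lower bdd) auto
  have "\<exists>x. J x < m + 1 / real (Suc n)" for n
    using cINF_less_iff[OF _ bdd, of "m + 1 / real (Suc n)"] by (auto simp: m_def)
  then obtain x where x: "\<And>n. J (x n) < m + 1 / real (Suc n)" by metis
  \<comment> \<open>Parallelogram law; bounding \<open>J\<close> at the midpoint below by
    \<open>m\<close> makes every minimising sequence Cauchy.\<close>
  have par: "(norm (y - z))\<^sup>2 \<le> 2 * (J y - m) + 2 * (J z - m)" for y z
  proof -
    have "(norm (y - z))\<^sup>2 + 4 * J ((1/2) *\<^sub>R (y + z)) = 2 * J y + 2 * J z"
      unfolding J_def by (simp add: scaleR add power2_norm_eq_inner algebra_simps inner_commute)
    then show ?thesis using m_le[of "(1/2) *\<^sub>R (y + z)"] by (smt (verit))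
  qed
  have "Cauchy x"
  proof (rule metric_CauchyI)
    fix e :: real assume "e > 0"
    then obtain N where N: "1 / real (Suc N) < e\<^sup>2 / 4"
      using nat_approx_posE[of "e\<^sup>2/4"] by auto
    have "dist (x i) (x j) < e" if "i \<ge> N" "j \<ge> N" for i j
    proof -
      have "1 / real (Suc i) \<le> 1 / real (Suc N)" "1 / real (Suc j) \<le> 1 / real (Suc N)"
        using that by (auto simp: field_simps)
      then have "J (x i) - m < e\<^sup>2 / 4" "J (x j) - m < e\<^sup>2 / 4"
        using x[of i] x[of j] N by linarith+
      then have "(norm (x i - x j))\<^sup>2 < e\<^sup>2"
        using par[of "x i" "x j"] by argo
      then show ?thesis using \<open>e > 0\<close> by (simp add: dist_norm power2_less_imp_less)
    qed
    then show "\<exists>M. \<forall>i\<ge>M. \<forall>j\<ge>M. dist (x i) (x j) < e" by blast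
  qed
  then obtain u where u: "x \<longlonglongrightarrow> u" using Cauchy_convergent_iff convergent_def by metis
  have "(\<lambda>n. J (x n)) \<longlonglongrightarrow> J u"
    unfolding J_def by (intro tendsto_intros u tendsto)
  moreover have "(\<lambda>n. m + 1 / real (Suc n)) \<longlonglongrightarrow> m + 0"
    by (intro tendsto_intros LIMSEQ_Suc lim_1_over_n)
  ultimately have "J u \<le> m + 0"
    by (rule LIMSEQ_le) (use x less_imp_le in auto)
  then have "J u \<le> J (u + t *\<^sub>R w)" for t w using m_le[of "u + t *\<^sub>R w"] by simp
  moreover have "J (u + t *\<^sub>R w) = J u - t * (2 * (f w - u \<bullet> w)) + t\<^sup>2 * (w \<bullet> w)" for t w
    unfolding J_def power2_norm_eq_inner
    by (simp add: scaleR add inner_add_left inner_add_right inner_commute[of w u] power2_eq_square algebra_simps)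
  ultimately have "t * (2 * (f w - u \<bullet> w)) \<le> t\<^sup>2 * (w \<bullet> w)" for t w
    by (smt (verit))
  then have "2 * (f w - u \<bullet> w) = 0" for w by (rule linear_le_quadratic_imp_zero)
  then have "f = (\<lambda>x. u \<bullet> x)" by auto
  then show thesis by (rule that)
qed

text \<open>The norm bound makes the functionals equicontinuous, so the Cauchy property spreads from
  \<open>D\<close> to all vectors; the pointwise limit is bounded linear and has a Riesz
  vector.\<close>

lemma weak_convergence_from_dense:
  fixes u :: "nat \<Rightarrow> 'a::{real_inner, complete_space}"
  assumes u: "\<And>n. norm (u n) \<le> 1"
    and dense: "\<And>x e. e > 0 \<Longrightarrow> \<exists>y\<in>D. dist y x < e"
    and conv: "\<And>y. y \<in> D \<Longrightarrow> convergent (\<lambda>n. u n \<bullet> y)"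
  obtains w where "norm w \<le> 1" "\<And>x. (\<lambda>n. u n \<bullet> x) \<longlonglongrightarrow> w \<bullet> x"
proof -
  have bound: "\<bar>u n \<bullet> x\<bar> \<le> norm x" for n x
    using Cauchy_Schwarz_ineq2[of "u n" x] mult_right_mono[OF u[of n], of "norm x"] by simp
  have "Cauchy (\<lambda>n. u n \<bullet> x)" for x
  proof (rule metric_CauchyI)
    fix e :: real assume "e > 0"
    then obtain y where y: "y \<in> D" "dist y x < e / 3" using dense[of "e/3"] by auto
    then obtain N where N: "\<And>i j. i \<ge> N \<Longrightarrow> j \<ge> N \<Longrightarrow> dist (u i \<bullet> y) (u j \<bullet> y) < e / 3"
      using conv[OF y(1)] \<open>e > 0\<close> convergent_Cauchy metric_CauchyD[of "\<lambda>n. u n \<bullet> y" "e/3"]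
      by (metis divide_pos_pos zero_less_numeral)
    have "dist (u i \<bullet> x) (u j \<bullet> x) < e" if "i \<ge> N" "j \<ge> N" for i j
    proof -
      have "\<bar>u k \<bullet> y - u k \<bullet> x\<bar> < e / 3" for k
        using bound[of k "y - x"] y(2) by (simp add: dist_norm inner_diff_right)
      from this[of i] this[of j] N[OF that] show ?thesis
        unfolding dist_real_def by linarith
    qed
    then show "\<exists>M. \<forall>i\<ge>M. \<forall>j\<ge>M. dist (u i \<bullet> x) (u j \<bullet> x) < e" by blast
  qed
  then have "\<exists>l. (\<lambda>n. u n \<bullet> x) \<longlonglongrightarrow> l" for x
    by (simp add: Cauchy_convergent_iff convergent_def)
  then obtain f where f: "\<And>x. (\<lambda>n. u n \<bullet> x) \<longlonglongrightarrow> f x" by metis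
  have "bounded_linear f"
  proof (rule bounded_linear_intro[where K = 1])
    show "f (x + y) = f x + f y" for x y
      using tendsto_add[OF f f, of x y] f[of "x + y"] LIMSEQ_unique
      by (auto simp: inner_add_right)
    show "f (r *\<^sub>R x) = r *\<^sub>R f x" for r x
      using tendsto_mult_left[OF f, of r x] f[of "r *\<^sub>R x"] LIMSEQ_unique by auto
    show "norm (f x) \<le> norm x * 1" for x
      using tendsto_rabs[OF f, of x] by (intro LIMSEQ_le_const2) (use bound in auto)
  qed
  then obtain w where w: "f = (\<lambda>x. w \<bullet> x)" by (rule riesz_representation)
  \<comment> \<open>Testing the weak limit against \<open>w\<close> itself gives the norm
    bound.\<close>
  have "w \<bullet> w \<le> norm w"
    using f[of w] bound[of _ w] by (intro LIMSEQ_le_const2) (auto simp: w abs_le_iff)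
  then have "norm w * norm w \<le> norm w" by (simp add: power2_norm_eq_inner[symmetric] power2_eq_square)
  then have "norm w \<le> 1" by (cases "w = 0") auto
  with f show thesis by (auto simp: w intro: that)
qed

text \<open>Sequential weak compactness of the unit ball, by a diagonal argument over a countable
  dense set.\<close>

lemma weakly_convergent_subsequence:
  fixes u :: "nat \<Rightarrow> 'a::{real_inner, polish_space}"
  assumes u: "\<And>n. norm (u n) \<le> 1"
  obtains r w where "strict_mono r" "norm w \<le> 1" "\<And>x. (\<lambda>n. u (r n) \<bullet> x) \<longlonglongrightarrow> w \<bullet> x"
proof -
  obtain D :: "'a set" where D: "countable D" "\<And>X. open X \<Longrightarrow> X \<noteq> {} \<Longrightarrow> \<exists>d\<in>D. d \<in> X"
    using countable_dense_setE by blast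
  have dense: "\<exists>y\<in>D. dist y x < e" if "e > 0" for x e
    using D(2)[of "ball x e"] that by (auto simp: dist_commute)
  then have "D \<noteq> {}" using zero_less_one by blast
  define P where "P k s = convergent (\<lambda>n. u (s n) \<bullet> from_nat_into D k)" for k and s :: "nat \<Rightarrow> nat"
  interpret subseqs P
  proof
    fix k and s :: "nat \<Rightarrow> nat"
    have "\<bar>u (s n) \<bullet> from_nat_into D k\<bar> \<le> norm (from_nat_into D k)" for n
      using Cauchy_Schwarz_ineq2[of "u (s n)" "from_nat_into D k"]
        mult_right_mono[OF u[of "s n"], of "norm (from_nat_into D k)"] by simp
    then have "bounded (range (\<lambda>n. u (s n) \<bullet> from_nat_into D k))"
      by (auto simp: bounded_iff)
    from bounded_imp_convergent_subsequence[OF this]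
    show "\<exists>r'. strict_mono r' \<and> P k (s \<circ> r')"
      by (auto simp: P_def o_def convergent_def)
  qed
  \<comment> \<open>The diagonal sequence is controlled by the \<open>k\<close>-th extraction only
    from index \<open>Suc k\<close> on; the terms before are irrelevant for convergence.\<close>
  have "P k (diagseq \<circ> ((+) (Suc k)))" for k
  proof (rule diagseq_holds)
    show "P n (s \<circ> r)" if "strict_mono r" "P n s" for r s n
      using convergent_subseq_convergent[OF that(2)[unfolded P_def] that(1)]
      by (simp add: P_def o_def)
  qed
  then have "convergent (\<lambda>n. u (diagseq n) \<bullet> y)" if "y \<in> D" for y
  proof -
    obtain k where k: "y = from_nat_into D k"
      using \<open>y \<in> D\<close> D(1) from_nat_into_surj by metis
    have "convergent (\<lambda>n. u (diagseq (n + Suc k)) \<bullet> y)"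
      using \<open>P k (diagseq \<circ> ((+) (Suc k)))\<close> by (simp add: P_def o_def k add.commute)
    then show ?thesis by (subst (asm) convergent_ignore_initial_segment)
  qed
  then obtain w where "norm w \<le> 1" "\<And>x. (\<lambda>n. u (diagseq n) \<bullet> x) \<longlonglongrightarrow> w \<bullet> x"
    using weak_convergence_from_dense[of "\<lambda>n. u (diagseq n)" D] u dense by metis
  with subseq_diagseq show thesis by (rule that)
qed

section \<open>Covariance and diagonalisation\<close>

locale gaussian_hilbert =
  fixes \<mu> :: "'a::{real_inner, polish_space} measure"
  assumes gaussian: "centred_gaussian_measure \<mu>"
    and nondegenerate: "nondegenerate \<mu>"
begin

sublocale prob_space \<mu>
  using gaussian by (simp add: centred_gaussian_measure_def)

lemma sets_borel [measurable_cong, simp]: "sets \<mu> = sets borel"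
  using gaussian by (simp add: centred_gaussian_measure_def)

lemma space_UNIV [simp]: "space \<mu> = UNIV"
  using sets_eq_imp_space_eq[OF sets_borel] by simp

definition covar :: "'a \<Rightarrow> 'a \<Rightarrow> real" where
  "covar u v = expectation (\<lambda>x. (u \<bullet> x) * (v \<bullet> x))"

text \<open>The quadratic form of the covariance operator; it is the variance because the
  functionals are centred (\<open>variance_inner\<close>).\<close>

definition q :: "'a \<Rightarrow> real" where
  "q u = covar u u"

lemma q_zero [simp]: "q 0 = 0"
  by (simp add: q_def covar_def)

lemma q_eq: "q u = expectation (\<lambda>x. (u \<bullet> x)\<^sup>2)"
  by (simp add: q_def covar_def power2_eq_square)

lemma marginal_normal:
  assumes "u \<noteq> 0"
  obtains \<sigma> where "\<sigma> > 0" "distributed \<mu> lborel (\<lambda>x. u \<bullet> x) (normal_density 0 \<sigma>)"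
proof -
  have bl: "bounded_linear (\<lambda>x. u \<bullet> x)" by (rule bounded_linear_inner_right)
  from gaussian bl obtain \<sigma> where \<sigma>: "\<sigma> \<ge> 0"
    "distr \<mu> borel (\<lambda>x. u \<bullet> x) = centred_gaussian_law \<sigma>"
    unfolding centred_gaussian_measure_def by blast
  have "(\<lambda>x. u \<bullet> x) \<noteq> (\<lambda>x. 0)"
    using \<open>u \<noteq> 0\<close> by (metis inner_eq_zero_iff)
  then have var: "variance (\<lambda>x. u \<bullet> x) > 0"
    using nondegenerate bl by (simp add: nondegenerate_def)
  \<comment> \<open>\<open>\<sigma> = 0\<close> is the Dirac case, which has zero variance and is
    excluded by non-degeneracy.\<close>
  have "\<sigma> \<noteq> 0"
  proof
    assume "\<sigma> = 0"
    then have law: "distr \<mu> borel (\<lambda>x. u \<bullet> x) = return borel 0"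
      using \<sigma> by (simp add: centred_gaussian_law_def)
    have eq: "expectation (\<lambda>x. f (u \<bullet> x)) = f 0" if [measurable]: "f \<in> borel_measurable borel" for f :: "real \<Rightarrow> real"
    proof -
      have "expectation (\<lambda>x. f (u \<bullet> x)) = (\<integral>y. f y \<partial>distr \<mu> borel (\<lambda>x. u \<bullet> x))"
        by (subst integral_distr) auto
      then show ?thesis by (simp add: law integral_return)
    qed
    have "variance (\<lambda>x. u \<bullet> x) = 0"
      using eq[of "\<lambda>y. y"] eq[of "\<lambda>y. y\<^sup>2"] by simp
    with var show False by simp
  qed
  with \<sigma> have "\<sigma> > 0" "distr \<mu> borel (\<lambda>x. u \<bullet> x) = density lborel (normal_density 0 \<sigma>)"
    by (auto simp: centred_gaussian_law_def)
  moreover have "distr \<mu> borel (\<lambda>x. u \<bullet> x) = distr \<mu> lborel (\<lambda>x. u \<bullet> x)"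
    by (rule distr_cong) auto
  ultimately show thesis
    by (intro that[of \<sigma>]) (auto simp: distributed_def)
qed

lemma integrable_inner_square: "integrable \<mu> (\<lambda>x. (u \<bullet> x)\<^sup>2)"
  and expectation_inner: "expectation (\<lambda>x. u \<bullet> x) = 0"
proof -
  have "integrable \<mu> (\<lambda>x. (u \<bullet> x)\<^sup>2) \<and> expectation (\<lambda>x. u \<bullet> x) = 0"
  proof (cases "u = 0")
    case False
    then obtain \<sigma> where \<sigma>: "\<sigma> > 0" "distributed \<mu> lborel (\<lambda>x. u \<bullet> x) (normal_density 0 \<sigma>)"
      by (rule marginal_normal)
    have "integrable lborel (\<lambda>x. normal_density 0 \<sigma> x * (x - 0) ^ k)" for k
      by (rule integrable_normal_moment) (rule \<sigma>)
    from this[of 2] show ?thesis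
      using distributed_integrable[OF \<sigma>(2), of "\<lambda>x. x\<^sup>2"]
        normal_distributed_expectation[OF \<sigma>]
      by auto
  qed auto
  then show "integrable \<mu> (\<lambda>x. (u \<bullet> x)\<^sup>2)"
    "expectation (\<lambda>x. u \<bullet> x) = 0" by auto
qed

lemma variance_inner: "variance (\<lambda>x. u \<bullet> x) = q u"
  by (simp add: expectation_inner q_eq)

lemma q_pos: "u \<noteq> 0 \<Longrightarrow> q u > 0"
  using nondegenerate bounded_linear_inner_right[of u] inner_eq_zero_iff[of u]
  unfolding nondegenerate_def variance_inner[symmetric] by (metis (no_types))

lemma q_nonneg: "q u \<ge> 0"
  by (simp add: q_eq)

lemma distributed_inner:
  assumes "u \<noteq> 0"
  shows "distributed \<mu> lborel (\<lambda>x. u \<bullet> x) (normal_density 0 (sqrt (q u)))"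
proof -
  obtain \<sigma> where \<sigma>: "\<sigma> > 0" "distributed \<mu> lborel (\<lambda>x. u \<bullet> x) (normal_density 0 \<sigma>)"
    using assms by (rule marginal_normal)
  have "q u = \<sigma>\<^sup>2"
    using normal_distributed_variance[OF \<sigma>] variance_inner by simp
  with \<sigma> show ?thesis by simp
qed

lemma distr_inner:
  assumes "u \<noteq> 0"
  shows "distr \<mu> borel (\<lambda>x. u \<bullet> x) = density lborel (normal_density 0 (sqrt (q u)))"
proof -
  have "distr \<mu> borel (\<lambda>x. u \<bullet> x) = distr \<mu> lborel (\<lambda>x. u \<bullet> x)"
    by (rule distr_cong) auto
  then show ?thesis using distributed_inner[OF assms] by (simp add: distributed_def)
qed

text \<open>Rescaling by the standard deviation reduces to the standard normal law;
  \<open>u = 0\<close> has no density and is treated apart.\<close>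

lemma char_inner: "expectation (\<lambda>x. iexp (t * (u \<bullet> x))) = complex_of_real (exp (- t\<^sup>2 * q u / 2))"
proof (cases "u = 0")
  case False
  define \<sigma> where "\<sigma> = sqrt (q u)"
  have \<sigma>: "\<sigma> > 0" using q_pos[OF False] by (simp add: \<sigma>_def)
  have "distributed \<mu> lborel (\<lambda>x. (u \<bullet> x) / \<sigma>) std_normal_density"
    using distributed_inner[OF False] normal_standard_normal_convert[OF \<sigma>, of "\<lambda>x. u \<bullet> x" 0]
    by (simp add: \<sigma>_def)
  then have std: "distr \<mu> borel (\<lambda>x. (u \<bullet> x) / \<sigma>) = std_normal_distribution"
    by (subst distr_cong[OF refl sets_lborel[symmetric] refl]) (auto simp: distributed_def)
  have "expectation (\<lambda>x. iexp (t * (u \<bullet> x))) = expectation (\<lambda>x. iexp ((t * \<sigma>) * ((u \<bullet> x) / \<sigma>)))"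
    using \<sigma> by simp
  also have "\<dots> = char (distr \<mu> borel (\<lambda>x. (u \<bullet> x) / \<sigma>)) (t * \<sigma>)"
    unfolding char_def by (subst integral_distr) auto
  also have "\<dots> = complex_of_real (exp (- t\<^sup>2 * q u / 2))"
    using q_nonneg[of u]
    unfolding std by (simp add: char_std_normal_distribution \<sigma>_def power_mult_distrib)
  finally show ?thesis .
qed (simp add: prob_space[simplified])

text \<open>Expresses \<open>q u\<close> through the integral of a bounded function, so that
  dominated convergence has the constant majorant 1 in \<open>q_weakly_continuous\<close>.\<close>

lemma expectation_cos_inner: "expectation (\<lambda>x. cos (u \<bullet> x)) = exp (- q u / 2)"
proof -
  have "integrable \<mu> (\<lambda>x. iexp (u \<bullet> x))" by (rule integrable_iexp) auto
  then have "expectation (\<lambda>x. Re (iexp (u \<bullet> x))) = Re (expectation (\<lambda>x. iexp (u \<bullet> x)))"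
    by (rule integral_Re)
  then show ?thesis using char_inner[of 1 u] by (simp add: Re_exp)
qed

lemma q_weakly_continuous:
  assumes "\<And>x. (\<lambda>n. u n \<bullet> x) \<longlonglongrightarrow> w \<bullet> x"
  shows "(\<lambda>n. q (u n)) \<longlonglongrightarrow> q w"
proof -
  have "(\<lambda>n. expectation (\<lambda>x. cos (u n \<bullet> x))) \<longlonglongrightarrow> expectation (\<lambda>x. cos (w \<bullet> x))"
    by (rule integral_dominated_convergence[where w = "\<lambda>_. 1"])
      (auto intro!: tendsto_cos assms)
  then have "(\<lambda>n. - 2 * ln (exp (- q (u n) / 2))) \<longlonglongrightarrow> - 2 * ln (exp (- q w / 2))"
    unfolding expectation_cos_inner by (rule tendsto_mult_left[OF tendsto_ln]) simp
  then show ?thesis unfolding ln_exp by simp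
qed

lemma covar_integrable: "integrable \<mu> (\<lambda>x. (u \<bullet> x) * (v \<bullet> x))"
proof (rule Bochner_Integration.integrable_bound)
  show "integrable \<mu> (\<lambda>x. (u \<bullet> x)\<^sup>2 + (v \<bullet> x)\<^sup>2)"
    by (intro Bochner_Integration.integrable_add integrable_inner_square)
  show "AE x in \<mu>. norm ((u \<bullet> x) * (v \<bullet> x)) \<le> norm ((u \<bullet> x)\<^sup>2 + (v \<bullet> x)\<^sup>2)"
  proof (rule AE_I2)
    fix x
    have "2 * (\<bar>u \<bullet> x\<bar> * \<bar>v \<bullet> x\<bar>) \<le> (u \<bullet> x)\<^sup>2 + (v \<bullet> x)\<^sup>2"
      using sum_squares_bound[of "\<bar>u \<bullet> x\<bar>" "\<bar>v \<bullet> x\<bar>"] by simp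
    moreover have "0 \<le> \<bar>u \<bullet> x\<bar> * \<bar>v \<bullet> x\<bar>" by simp
    ultimately have "\<bar>u \<bullet> x\<bar> * \<bar>v \<bullet> x\<bar> \<le> (u \<bullet> x)\<^sup>2 + (v \<bullet> x)\<^sup>2" by argo
    then show "norm ((u \<bullet> x) * (v \<bullet> x)) \<le> norm ((u \<bullet> x)\<^sup>2 + (v \<bullet> x)\<^sup>2)"
      by (simp add: abs_mult)
  qed
qed auto

lemma covar_commute: "covar u v = covar v u"
  by (simp add: covar_def mult.commute)

lemma covar_add_right: "covar u (v + w) = covar u v + covar u w"
  unfolding covar_def
  by (simp add: inner_add_left algebra_simps Bochner_Integration.integral_add[OF covar_integrable covar_integrable])

lemma covar_scaleR_right: "covar u (t *\<^sub>R v) = t * covar u v"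
  unfolding covar_def by (simp add: mult.left_commute)

lemma covar_zero_right [simp]: "covar u 0 = 0"
  by (simp add: covar_def)

lemma covar_sum_right: "covar u (\<Sum>i\<in>I. f i) = (\<Sum>i\<in>I. covar u (f i))"
  by (induction I rule: infinite_finite_induct) (auto simp: covar_add_right)

lemma q_add: "q (u + v) = q u + 2 * covar u v + q v"
  by (simp add: q_def covar_add_right covar_commute[of "u + v"] covar_commute[of v u])

lemma q_scaleR: "q (t *\<^sub>R u) = t\<^sup>2 * q u"
  by (simp add: q_def covar_scaleR_right covar_commute[of "t *\<^sub>R u"] power2_eq_square)

text \<open>Riesz representation replaces continuous functionals by vectors.\<close>

lemma cm_values_eq: "cm_values \<mu> h = {u \<bullet> h | u. q u \<le> 1}"
  unfolding cm_values_def
proof safe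
  fix l :: "'a \<Rightarrow> real" assume l: "bounded_linear l" "variance l \<le> 1"
  from l(1) obtain u where "l = (\<lambda>x. u \<bullet> x)" by (rule riesz_representation)
  with l(2) show "\<exists>u. l h = u \<bullet> h \<and> q u \<le> 1" by (auto simp: variance_inner)
next
  fix u assume "q u \<le> 1"
  then show "\<exists>l. u \<bullet> h = l h \<and> bounded_linear l \<and> variance l \<le> 1"
    by (intro exI[of _ "\<lambda>x. u \<bullet> x"]) (simp add: variance_inner bounded_linear_inner_right)
qed

text \<open>The norm bound and the orthogonality constraints survive weak limits, so the weak limit
  of a maximising sequence is admissible and attains the supremum.\<close>

lemma variance_maximiser:
  fixes S :: "'a set"
  obtains w where "norm w \<le> 1" "\<And>s. s \<in> S \<Longrightarrow> s \<bullet> w = 0"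
    "\<And>u. norm u \<le> 1 \<Longrightarrow> (\<And>s. s \<in> S \<Longrightarrow> s \<bullet> u = 0) \<Longrightarrow> q u \<le> q w"
proof -
  define W where "W = {u. norm u \<le> 1 \<and> (\<forall>s\<in>S. s \<bullet> u = 0)}"
  \<comment> \<open>Maximising \<open>q\<close> as a minimum of \<open>exp (- q u / 2)\<close> needs no a priori bound on \<open>q\<close>.\<close>
  define m where "m = (INF u\<in>W. exp (- q u / 2))"
  have "0 \<in> W" by (simp add: W_def)
  then have ne: "W \<noteq> {}" by auto
  have bdd: "bdd_below ((\<lambda>u. exp (- q u / 2)) ` W)" by (intro bdd_belowI2[where m = 0]) simp
  have "\<exists>u\<in>W. exp (- q u / 2) < m + 1 / real (Suc n)" for n
    using cINF_less_iff[OF ne bdd, of "m + 1 / real (Suc n)"] by (simp add: m_def)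
  then obtain u where u: "\<And>n. u n \<in> W" "\<And>n. exp (- q (u n) / 2) < m + 1 / real (Suc n)" by metis
  obtain r w where r: "strict_mono r" and w: "norm w \<le> 1" "\<And>x. (\<lambda>n. u (r n) \<bullet> x) \<longlonglongrightarrow> w \<bullet> x"
    using weakly_convergent_subsequence[of u] u(1) by (auto simp: W_def)
  have "s \<bullet> w = 0" if "s \<in> S" for s
  proof -
    have "(\<lambda>n. u (r n) \<bullet> s) = (\<lambda>n. 0)" using u(1) that by (auto simp: W_def inner_commute)
    then show ?thesis using w(2)[of s] LIMSEQ_unique by (auto simp: inner_commute)
  qed
  moreover have "exp (- q w / 2) \<le> m + 0"
  proof (rule LIMSEQ_le)
    show "(\<lambda>n. exp (- q (u (r n)) / 2)) \<longlonglongrightarrow> exp (- q w / 2)"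
      by (intro tendsto_intros q_weakly_continuous w) auto
    have "(\<lambda>n. m + 1 / real (Suc n)) \<longlonglongrightarrow> m + 0"
      by (intro tendsto_intros LIMSEQ_Suc lim_1_over_n)
    from LIMSEQ_subseq_LIMSEQ[OF this r]
    show "(\<lambda>n. m + 1 / real (Suc (r n))) \<longlonglongrightarrow> m + 0" by (simp add: o_def)
    show "\<exists>N. \<forall>n\<ge>N. exp (- q (u (r n)) / 2) \<le> m + 1 / real (Suc (r n))"
      using u(2) less_imp_le by blast
  qed
  moreover have "m \<le> exp (- q y / 2)" if "y \<in> W" for y
    unfolding m_def by (intro cINF_lower bdd that)
  ultimately have "q y \<le> q w" if "y \<in> W" for y
  proof -
    have "exp (- q w / 2) \<le> exp (- q y / 2)"
      using \<open>exp (- q w / 2) \<le> m + 0\<close> \<open>\<And>y. y \<in> W \<Longrightarrow> m \<le> exp (- q y / 2)\<close>[OF that] by linarith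
    then show ?thesis by simp
  qed
  then show thesis
    using \<open>\<And>s. s \<in> S \<Longrightarrow> s \<bullet> w = 0\<close> by (intro that[of w] w(1)) (auto simp: W_def)
qed

end

text \<open>
  The vectors are taken from the unit ball, not the unit sphere, so that finite-dimensional spaces
  are covered: \<open>v n = 0\<close> once \<open>v 0, \<dots>, v (n - 1)\<close> span the space.
\<close>

locale gaussian_hilbert_basis = gaussian_hilbert +
  fixes v :: "nat \<Rightarrow> 'a"
  assumes norm_v_le: "norm (v n) \<le> 1"
    and orth_less: "i < n \<Longrightarrow> v i \<bullet> v n = 0"
    and v_maximal: "norm u \<le> 1 \<Longrightarrow> (\<And>i. i < n \<Longrightarrow> v i \<bullet> u = 0) \<Longrightarrow> q u \<le> q (v n)"

lemma (in gaussian_hilbert) gaussian_hilbert_basis_exists: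
  obtains v where "gaussian_hilbert_basis \<mu> v"
proof -
  have "\<forall>S. \<exists>w. norm w \<le> 1 \<and> (\<forall>s\<in>S. s \<bullet> w = 0) \<and>
     (\<forall>u. norm u \<le> 1 \<longrightarrow> (\<forall>s\<in>S. s \<bullet> u = 0) \<longrightarrow> q u \<le> q w)"
    using variance_maximiser by metis
  then obtain G where G: "\<And>S. norm (G S) \<le> 1" "\<And>S s. s \<in> S \<Longrightarrow> s \<bullet> G S = 0"
    "\<And>S u. norm u \<le> 1 \<Longrightarrow> (\<And>s. s \<in> S \<Longrightarrow> s \<bullet> u = 0) \<Longrightarrow> q u \<le> q (G S)"
    by metis
  \<comment> \<open>\<open>T n\<close> is the set of vectors chosen before stage \<open>n\<close>;
    iterating on sets turns the choice depending on all predecessors into a primitive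
    recursion.\<close>
  define T where "T = rec_nat {} (\<lambda>_ S. insert (G S) S)"
  define v where "v n = G (T n)" for n
  have T: "T n = v ` {..<n}" for n
    by (induction n) (auto simp: T_def v_def lessThan_Suc)
  have "gaussian_hilbert_basis \<mu> v"
  proof
    show "norm (v n) \<le> 1" for n by (simp add: v_def G)
    show "v i \<bullet> v n = 0" if "i < n" for i n
      using G(2)[of "v i" "T n"] that by (auto simp: T v_def[of n])
    show "q u \<le> q (v n)" if "norm u \<le> 1" "\<And>i. i < n \<Longrightarrow> v i \<bullet> u = 0" for u n
      using G(3)[of u "T n"] that by (auto simp: T v_def[of n])
  qed
  then show thesis by (rule that)
qed

section \<open>Spectral properties and completeness of the system \<open>v\<close>\<close>

context gaussian_hilbert_basis
begin

lemma q_le_of_orth: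
  assumes "\<And>i. i < n \<Longrightarrow> v i \<bullet> u = 0"
  shows "q u \<le> q (v n) * (norm u)\<^sup>2"
proof (cases "u = 0")
  case False
  have "q ((1 / norm u) *\<^sub>R u) \<le> q (v n)"
    using False assms by (intro v_maximal) auto
  with False show ?thesis by (simp add: q_scaleR field_simps)
qed simp

text \<open>A nonzero maximiser in the interior of the ball could be scaled up, increasing
  \<open>q\<close>.\<close>

lemma norm_v: "v n \<noteq> 0 \<Longrightarrow> norm (v n) = 1"
proof -
  assume "v n \<noteq> 0"
  have "q (v n) * 1 \<le> q (v n) * (norm (v n))\<^sup>2" using q_le_of_orth[of n "v n"] orth_less by simp
  then have "1 \<le> norm (v n)"
    using q_pos[OF \<open>v n \<noteq> 0\<close>] by (simp add: abs_le_square_iff[of 1 "norm (v n)", simplified])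
  with norm_v_le[of n] show ?thesis by simp
qed

lemma orth: "i \<noteq> j \<Longrightarrow> v i \<bullet> v j = 0"
  using orth_less by (metis inner_commute linorder_neqE_nat)

text \<open>First-order condition for the maximality of \<open>v i\<close>: moving it along
  \<open>t *\<^sub>R w\<close> changes the squared norm only at order two in \<open>t\<close>, but
  \<open>q\<close> at order one with coefficient \<open>2 * covar (v i) w\<close>.\<close>

lemma covar_v_orth:
  assumes "\<And>j. j \<le> i \<Longrightarrow> v j \<bullet> w = 0"
  shows "covar (v i) w = 0"
proof (cases "v i = 0")
  case False
  have "t * (2 * covar (v i) w) \<le> t\<^sup>2 * (q (v i) * (norm w)\<^sup>2 - q w)" for t
  proof -
    have "v i \<bullet> w = 0" using assms by simp
    have "q (v i + t *\<^sub>R w) \<le> q (v i) * (norm (v i + t *\<^sub>R w))\<^sup>2"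
      using assms orth_less by (intro q_le_of_orth) (auto simp: inner_add_right)
    moreover have "(norm (v i + t *\<^sub>R w))\<^sup>2 = 1 + t\<^sup>2 * (norm w)\<^sup>2"
      using norm_v[OF False] \<open>v i \<bullet> w = 0\<close> unfolding power2_norm_eq_inner norm_eq_1
      by (simp add: inner_add_left inner_add_right inner_commute[of w "v i"] power2_eq_square)
    ultimately show ?thesis
      by (simp add: q_add q_scaleR covar_scaleR_right algebra_simps)
  qed
  from linear_le_quadratic_imp_zero[OF this] show ?thesis by simp
qed (simp add: covar_def)

lemma covar_v: "i \<noteq> j \<Longrightarrow> covar (v i) (v j) = 0"
proof (induction i j rule: linorder_wlog)
  case (le i j)
  then show ?case using orth by (intro covar_v_orth) auto
qed (metis covar_commute)

lemma q_sum: "finite I \<Longrightarrow> q (\<Sum>i\<in>I. s i *\<^sub>R v i) = (\<Sum>i\<in>I. (s i)\<^sup>2 * q (v i))"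
proof (induction I rule: finite_induct)
  case (insert i I)
  have "covar (v i) (\<Sum>i\<in>I. s i *\<^sub>R v i) = 0"
    using insert.hyps by (auto simp: covar_sum_right covar_scaleR_right intro!: sum.neutral covar_v)
  then have "covar (s i *\<^sub>R v i) (\<Sum>i\<in>I. s i *\<^sub>R v i) = 0"
    by (simp add: covar_commute[of "s i *\<^sub>R v i"] covar_scaleR_right covar_commute[of _ "v i"])
  with insert show ?case by (simp add: q_add q_scaleR)
qed simp

text \<open>The orthogonal projection onto the span of the first \<open>n\<close> vectors, since
  each \<open>v i\<close> is a unit vector or zero.\<close>

definition P :: "nat \<Rightarrow> 'a \<Rightarrow> 'a" where
  "P n u = (\<Sum>i<n. (v i \<bullet> u) *\<^sub>R v i)"

text \<open>Covers unit vectors and \<open>v i = 0\<close> at once, which spares later sums the case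
  distinction.\<close>

lemma v_inner_self: "(v i \<bullet> u) * (v i \<bullet> v i) = v i \<bullet> u"
  using norm_v[of i] by (cases "v i = 0") (auto simp: norm_eq_1)

lemma v_inner_P: "v j \<bullet> P n u = (if j < n then v j \<bullet> u else 0)"
proof -
  have "v j \<bullet> P n u = (\<Sum>i<n. if i = j then v j \<bullet> u else 0)"
    unfolding P_def inner_sum_right by (intro sum.cong) (auto simp: orth v_inner_self)
  then show ?thesis by simp
qed

lemma norm_P_sum: "(norm (\<Sum>i\<in>A. (v i \<bullet> u) *\<^sub>R v i))\<^sup>2 = (\<Sum>i\<in>A. (v i \<bullet> u)\<^sup>2)" if "finite A"
proof -
  have "(\<Sum>j\<in>A. (v i \<bullet> u) * ((v j \<bullet> u) * (v j \<bullet> v i))) = (v i \<bullet> u)\<^sup>2" if "i \<in> A" for i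
  proof -
    have "(\<Sum>j\<in>A. (v i \<bullet> u) * ((v j \<bullet> u) * (v j \<bullet> v i))) = (\<Sum>j\<in>A. if j = i then (v i \<bullet> u)\<^sup>2 else 0)"
      by (intro sum.cong) (auto simp: orth v_inner_self power2_eq_square)
    then show ?thesis using \<open>finite A\<close> that by simp
  qed
  then show ?thesis
    unfolding power2_norm_eq_inner
    by (simp add: inner_sum_left inner_sum_right sum_distrib_left)
qed

lemma norm_P: "(norm (P n u))\<^sup>2 = (\<Sum>i<n. (v i \<bullet> u)\<^sup>2)"
  unfolding P_def by (rule norm_P_sum) simp

lemma norm_split: "(norm u)\<^sup>2 = (norm (P n u))\<^sup>2 + (norm (u - P n u))\<^sup>2"
proof -
  have "P n u \<bullet> (u - P n u) = 0"
    unfolding P_def[of n u] inner_sum_left inner_scaleR_left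
    by (intro sum.neutral) (simp add: inner_diff_right P_def[symmetric] v_inner_P)
  then show ?thesis
    by (simp add: power2_norm_eq_inner inner_diff_left inner_diff_right inner_commute)
qed

lemma bessel: "(\<Sum>i<n. (v i \<bullet> u)\<^sup>2) \<le> (norm u)\<^sup>2"
  using norm_split[of u n] by (simp add: norm_P)

lemma bessel_summable: "summable (\<lambda>i. (v i \<bullet> u)\<^sup>2)"
  by (rule summableI_nonneg_bounded[where x = "(norm u)\<^sup>2"]) (auto intro: bessel)

text \<open>By Bessel the \<open>v n\<close> tend weakly to 0, and \<open>q\<close> is weakly
  continuous. This expresses the compactness of the covariance operator.\<close>

lemma q_v_tendsto_0: "(\<lambda>n. q (v n)) \<longlonglongrightarrow> 0"
proof -
  have "(\<lambda>n. v n \<bullet> x) \<longlonglongrightarrow> 0 \<bullet> x" for x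
    using tendsto_real_sqrt[OF summable_LIMSEQ_zero[OF bessel_summable[of x]]]
    by (simp add: tendsto_rabs_zero_iff)
  from q_weakly_continuous[OF this] show ?thesis by simp
qed

text \<open>A vector orthogonal to the whole system has variance at most \<open>q (v n)\<close>
  times its squared norm for every \<open>n\<close>, hence variance 0; non-degeneracy then makes it
  zero.\<close>

lemma eq_0_if_orth:
  assumes "\<And>i. v i \<bullet> u = 0"
  shows "u = 0"
proof (rule ccontr)
  assume "u \<noteq> 0"
  have "(\<lambda>n. q (v n) * (norm u)\<^sup>2) \<longlonglongrightarrow> 0 * (norm u)\<^sup>2"
    by (intro tendsto_intros q_v_tendsto_0)
  then have "q u \<le> 0 * (norm u)\<^sup>2"
    using q_le_of_orth[of _ u] assms by (intro LIMSEQ_le_const) auto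
  with q_pos[OF \<open>u \<noteq> 0\<close>] show False by simp
qed

text \<open>Bessel makes the projections Cauchy; the difference between \<open>u\<close> and their
  limit is orthogonal to every \<open>v i\<close>, so \<open>eq_0_if_orth\<close> identifies the
  limit.\<close>

lemma P_tendsto: "(\<lambda>n. P n u) \<longlonglongrightarrow> u"
proof -
  have "Cauchy (\<lambda>n. P n u)"
  proof (rule CauchyI')
    fix e :: real assume "e > 0"
    then obtain N where N: "\<And>m n. m \<ge> N \<Longrightarrow> norm (\<Sum>i\<in>{m..<n}. (v i \<bullet> u)\<^sup>2) < e\<^sup>2"
      using bessel_summable[of u] unfolding summable_Cauchy by (meson zero_less_power)
    have "dist (P m u) (P n u) < e" if "m \<ge> N" "n > m" for m n
    proof -
      have "P n u - P m u = (\<Sum>i\<in>{m..<n}. (v i \<bullet> u) *\<^sub>R v i)"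
        unfolding P_def using that by (simp add: lessThan_atLeast0 sum_diff_nat_ivl)
      then have "(norm (P m u - P n u))\<^sup>2 = (\<Sum>i\<in>{m..<n}. (v i \<bullet> u)\<^sup>2)"
        by (simp add: norm_minus_commute[of "P m u"] norm_P_sum)
      also have "\<dots> < e\<^sup>2" using N[of m n] that by simp
      finally show ?thesis using \<open>e > 0\<close> by (simp add: dist_norm power2_less_imp_less)
    qed
    then show "\<exists>M. \<forall>m\<ge>M. \<forall>n>m. dist (P m u) (P n u) < e" by blast
  qed
  then obtain p where p: "(\<lambda>n. P n u) \<longlonglongrightarrow> p" using Cauchy_convergent_iff convergent_def by metis
  have "v i \<bullet> (u - p) = 0" for i
  proof -
    have "eventually (\<lambda>n. v i \<bullet> P n u = v i \<bullet> u) sequentially"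
      by (rule eventually_sequentiallyI[of "Suc i"]) (simp add: v_inner_P)
    then have "(\<lambda>n. v i \<bullet> P n u) \<longlonglongrightarrow> v i \<bullet> u" by (rule tendsto_eventually)
    moreover have "(\<lambda>n. v i \<bullet> P n u) \<longlonglongrightarrow> v i \<bullet> p" by (intro tendsto_intros p)
    ultimately show ?thesis using LIMSEQ_unique by (auto simp: inner_diff_right)
  qed
  then have "u = p" using eq_0_if_orth[of "u - p"] by simp
  with p show ?thesis by simp
qed

end

section \<open>Independence from characteristic functions\<close>

text \<open>Normalised, the weight \<open>W\<close> is a probability density under which
  \<open>X\<close> keeps its characteristic function, hence its law, by Levy's uniqueness theorem.
  The case of mean 0 cannot be normalised and is trivial.\<close>

lemma (in prob_space) indicator_expectation_if_char_factors:
  assumes [measurable]: "X \<in> borel_measurable M" "W \<in> borel_measurable M" "B \<in> sets borel"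
    and W: "\<And>x. 0 \<le> W x" "\<And>x. W x \<le> C"
    and char: "\<And>s. expectation (\<lambda>x. complex_of_real (W x) * iexp (s * X x)) =
                complex_of_real (expectation W) * expectation (\<lambda>x. iexp (s * X x))"
  shows "expectation (\<lambda>x. W x * indicator B (X x)) = expectation W * prob (X -` B \<inter> space M)"
proof -
  have intW: "integrable M W" by (rule integrable_const_bound[where B = C]) (use W in auto)
  define c where "c = expectation W"
  have c_nonneg: "c \<ge> 0" unfolding c_def using W by (intro Bochner_Integration.integral_nonneg) auto
  show ?thesis
  proof (cases "c = 0")
    case True
    then have "AE x in M. W x = 0"
      using integral_nonneg_eq_0_iff_AE[OF intW] W by (auto simp: c_def)
    then have "expectation (\<lambda>x. W x * indicator B (X x)) = expectation (\<lambda>x. 0)"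
      by (intro integral_cong_AE) auto
    with True show ?thesis by (simp add: c_def)
  next
    case False
    with c_nonneg have c: "c > 0" by simp
    define N where "N = density M (\<lambda>x. ennreal (W x / c))"
    have "(\<integral>\<^sup>+x. ennreal (W x / c) \<partial>M) = ennreal (expectation (\<lambda>x. W x / c))"
      using intW W c by (intro nn_integral_eq_integral) auto
    also have "\<dots> = 1" using c by (simp add: c_def)
    finally have "emeasure N (space N) = 1"
      unfolding N_def by (subst emeasure_density) (auto cong: nn_integral_cong_simp)
    then interpret N: prob_space N by (rule prob_spaceI)
    have [measurable_cong]: "sets N = sets M" by (simp add: N_def)
    have intN: "(\<integral>x. f x \<partial>N) = (\<integral>x. (W x / c) *\<^sub>R f x \<partial>M)"
      if [measurable]: "f \<in> borel_measurable M" for f :: "'a \<Rightarrow> 'b::{banach, second_countable_topology}"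
      unfolding N_def using W c by (subst integral_density) auto
    have "distr N borel X = distr M borel X"
    proof (rule Levy_uniqueness)
      show "real_distribution (distr N borel X)" by (rule N.real_distribution_distr) simp
      show "real_distribution (distr M borel X)" by (rule real_distribution_distr) simp
      show "Characteristic_Functions.char (distr N borel X) = Characteristic_Functions.char (distr M borel X)"
      proof
        fix s
        have "Characteristic_Functions.char (distr N borel X) s = (\<integral>x. iexp (s * X x) \<partial>N)"
          unfolding char_def by (subst integral_distr) auto
        also have "\<dots> = expectation (\<lambda>x. complex_of_real (W x) * iexp (s * X x) / complex_of_real c)"
          by (subst intN) (auto simp: scaleR_conv_of_real)
        also have "\<dots> = expectation (\<lambda>x. iexp (s * X x))"
          using c by (simp only: integral_divide_zero char) (simp add: c_def)
        also have "\<dots> = Characteristic_Functions.char (distr M borel X) s"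
          unfolding char_def by (subst integral_distr) auto
        finally show "Characteristic_Functions.char (distr N borel X) s = Characteristic_Functions.char (distr M borel X) s" .
      qed
    qed
    then have "measure (distr N borel X) B = measure (distr M borel X) B" by simp
    then have "measure N (X -` B \<inter> space M) = prob (X -` B \<inter> space M)"
      by (simp add: measure_distr N_def)
    moreover have "measure N (X -` B \<inter> space M) = (\<integral>x. indicator (X -` B \<inter> space M) x \<partial>N)"
      by (simp add: N_def)
    moreover have "\<dots> = expectation (\<lambda>x. W x * indicator B (X x) / c)"
      by (subst intN) (auto intro!: Bochner_Integration.integral_cong simp: indicator_def)
    ultimately show ?thesis using c by (simp add: c_def field_simps)
  qed
qed

lemma iexp_times_cos:
  "iexp r * complex_of_real (cos (t + \<theta>)) = (iexp \<theta> * iexp (t + r) + iexp (- \<theta>) * iexp (- t + r)) / 2"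
proof -
  have "complex_of_real (cos (t + \<theta>)) = (iexp (t + \<theta>) + iexp (- (t + \<theta>))) / 2"
    by (simp add: cos_of_real[symmetric] cos_exp_eq algebra_simps)
  then show ?thesis by (simp add: exp_add[symmetric] algebra_simps add_divide_distrib)
qed

text \<open>Reduces joint independence to the one-dimensional uniqueness theorem: each induction
  step absorbs one indicator into the weight. The work lies in showing that the new weight
  \<open>W'\<close> inherits the factorisation of characteristic functions, which amounts to
  applying the one-dimensional lemma to the weights \<open>W\<close> times cosine and sine of
  \<open>T s\<close>.\<close>

lemma (in prob_space) prod_indicator_expectation_if_char_factors:
  fixes X :: "'i \<Rightarrow> 'a \<Rightarrow> real"
  assumes "finite I"
    and [measurable]: "\<And>i. X i \<in> borel_measurable M" "\<And>i. B i \<in> sets borel"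
    and "W \<in> borel_measurable M" "\<And>x. 0 \<le> W x" "\<And>x. W x \<le> C"
    and "\<And>s. expectation (\<lambda>x. complex_of_real (W x) * iexp (\<Sum>i\<in>I. s i * X i x)) =
                complex_of_real (expectation W) * (\<Prod>i\<in>I. expectation (\<lambda>x. iexp (s i * X i x)))"
  shows "expectation (\<lambda>x. W x * (\<Prod>i\<in>I. indicator (B i) (X i x))) =
          expectation W * (\<Prod>i\<in>I. prob (X i -` B i \<inter> space M))"
  using assms(1,4-)
proof (induction I arbitrary: W C rule: finite_induct)
  case (insert k I)
  note [measurable] = insert.prems(1)
  have intW: "integrable M W"
    by (rule integrable_const_bound[where B = C]) (use insert.prems in auto)
  have C: "C \<ge> 0" using insert.prems(2,3) order_trans by blast
  define \<phi> where "\<phi> i t = expectation (\<lambda>x. iexp (t * X i x))" for i t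
  define T where "T s x = (\<Sum>i\<in>I. s i * X i x)" for s x
  have [measurable]: "T s \<in> borel_measurable M" for s unfolding T_def by measurable
  define p where "p = prob (X k -` B k \<inter> space M)"
  have joint: "expectation (\<lambda>x. complex_of_real (W x) * iexp (T s x + r * X k x)) =
      complex_of_real (expectation W) * (\<Prod>i\<in>I. \<phi> i (s i)) * \<phi> k r" for s r
  proof -
    have "(\<Sum>i\<in>insert k I. (s(k := r)) i * X i x) = T s x + r * X k x" for x
      using insert.hyps by (auto simp: T_def intro!: sum.cong)
    moreover have "(\<Prod>i\<in>insert k I. \<phi> i ((s(k := r)) i)) = \<phi> k r * (\<Prod>i\<in>I. \<phi> i (s i))"
      using insert.hyps by (auto intro!: prod.cong)
    ultimately show ?thesis
      using insert.prems(4)[of "s(k := r)"] by (simp only: \<phi>_def[symmetric]) (simp add: mult_ac)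
  qed
  have \<phi>0: "\<phi> i 0 = 1" for i by (simp add: \<phi>_def prob_space)
  have int_iexp: "integrable M (\<lambda>x. complex_of_real (W x) * iexp (f x))"
    if [measurable]: "f \<in> borel_measurable M" for f
    by (rule integrable_const_bound[where B = C])
      (use insert.prems(2,3) in \<open>auto simp: norm_mult\<close>)
  have factor: "expectation (\<lambda>x. W x * indicator (B k) (X k x)) = expectation W * p"
    unfolding p_def
  proof (rule indicator_expectation_if_char_factors)
    show "expectation (\<lambda>x. complex_of_real (W x) * iexp (s * X k x)) =
        complex_of_real (expectation W) * expectation (\<lambda>x. iexp (s * X k x))" for s
      using joint[of "\<lambda>_. 0" s] by (simp add: T_def \<phi>_def prob_space)
  qed (use insert.prems in auto)
  \<comment> \<open>The weights have to be nonnegative, so the phase enters through \<open>1 + cos\<close>.\<close>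
  have factor_cos: "expectation (\<lambda>x. W x * cos (T s x + \<theta>) * indicator (B k) (X k x)) =
      expectation (\<lambda>x. W x * cos (T s x + \<theta>)) * p" for s \<theta>
  proof -
    define V where "V x = W x * (1 + cos (T s x + \<theta>))" for x
    have [measurable]: "V \<in> borel_measurable M" unfolding V_def by measurable
    have V: "0 \<le> V x" "V x \<le> C * 2" for x
    proof -
      have c: "0 \<le> 1 + cos (T s x + \<theta>)" "1 + cos (T s x + \<theta>) \<le> 2"
        using cos_ge_minus_one[of "T s x + \<theta>"] cos_le_one[of "T s x + \<theta>"] by linarith+
      then show "0 \<le> V x" "V x \<le> C * 2"
        unfolding V_def using insert.prems(2,3)[of x] C by (auto intro: mult_mono)
    qed
    \<comment> \<open>The factor that the phase contributes to the mean of \<open>V\<close>; it is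
      read off from \<open>V_char\<close> at \<open>r = 0\<close>.\<close>
    define A where "A = 1 + (iexp \<theta> * (\<Prod>i\<in>I. \<phi> i (s i)) + iexp (- \<theta>) * (\<Prod>i\<in>I. \<phi> i (- s i))) / 2"
    have V_char: "expectation (\<lambda>x. complex_of_real (V x) * iexp (r * X k x)) =
        complex_of_real (expectation W) * A * \<phi> k r" for r
    proof -
      have neg: "- T s x = T (\<lambda>i. - s i) x" for x by (simp add: T_def sum_negf)
      have "complex_of_real (V x) * iexp (r * X k x) =
          complex_of_real (W x) * iexp (r * X k x)
          + (iexp \<theta> / 2) * (complex_of_real (W x) * iexp (T s x + r * X k x))
          + (iexp (- \<theta>) / 2) * (complex_of_real (W x) * iexp (T (\<lambda>i. - s i) x + r * X k x))" for x
      proof -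
        have "complex_of_real (V x) * iexp (r * X k x) = complex_of_real (W x) * (iexp (r * X k x)
            + iexp (r * X k x) * complex_of_real (cos (T s x + \<theta>)))"
          by (simp add: V_def algebra_simps)
        then show ?thesis
          unfolding iexp_times_cos neg[symmetric] by (simp add: algebra_simps add_divide_distrib)
      qed
      then have "expectation (\<lambda>x. complex_of_real (V x) * iexp (r * X k x)) =
          expectation (\<lambda>x. complex_of_real (W x) * iexp (r * X k x))
          + (iexp \<theta> / 2) * expectation (\<lambda>x. complex_of_real (W x) * iexp (T s x + r * X k x))
          + (iexp (- \<theta>) / 2) * expectation (\<lambda>x. complex_of_real (W x) * iexp (T (\<lambda>i. - s i) x + r * X k x))"
        using int_iexp[of "\<lambda>x. r * X k x"] int_iexp[of "\<lambda>x. T s x + r * X k x"]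
          int_iexp[of "\<lambda>x. T (\<lambda>i. - s i) x + r * X k x"]
        by (simp add: Bochner_Integration.integral_add Bochner_Integration.integrable_add)
      also have "expectation (\<lambda>x. complex_of_real (W x) * iexp (r * X k x)) = complex_of_real (expectation W) * \<phi> k r"
        using joint[of "\<lambda>_. 0" r] by (simp add: T_def \<phi>0)
      finally show ?thesis unfolding joint by (simp add: A_def algebra_simps add_divide_distrib)
    qed
    have "complex_of_real (expectation V) = complex_of_real (expectation W) * A"
      using V_char[of 0] by (simp add: \<phi>0)
    then have "expectation (\<lambda>x. V x * indicator (B k) (X k x)) = expectation V * p"
      unfolding p_def using V V_char
      by (intro indicator_expectation_if_char_factors) (auto simp: \<phi>_def)
    \<comment> \<open>Integrability of the separate terms allows \<open>factor\<close> to be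
      subtracted from the identity for \<open>V\<close>, which removes the constant 1 beside the
      cosine.\<close>
    moreover have int: "integrable M (\<lambda>x. W x * cos (T s x + \<theta>))"
      by (rule integrable_const_bound[where B = C])
        (use insert.prems(2,3) C in \<open>auto simp: abs_mult intro!: order_trans[OF mult_mono[OF _ abs_cos_le_one]]\<close>)
    moreover have "integrable M (\<lambda>x. W x * indicator (B k) (X k x))"
      by (rule integrable_const_bound[where B = C])
        (use insert.prems(2,3) C in \<open>auto simp: indicator_def\<close>)
    moreover have "integrable M (\<lambda>x. W x * cos (T s x + \<theta>) * indicator (B k) (X k x))"
      by (rule Bochner_Integration.integrable_bound[OF int]) (auto simp: indicator_def)
    ultimately show ?thesis
      using factor intW unfolding V_def[abs_def] by (simp add: algebra_simps)
  qed
  define W' where "W' x = W x * indicator (B k) (X k x)" for x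
  have [measurable]: "W' \<in> borel_measurable M" unfolding W'_def by measurable
  have W': "0 \<le> W' x" "W' x \<le> C" for x
    using insert.prems(2,3)[of x] C by (auto simp: W'_def indicator_def)
  have cis_int: "expectation (\<lambda>x. complex_of_real (U x) * iexp (T s x)) =
      complex_of_real (expectation (\<lambda>x. U x * cos (T s x))) + \<i> * complex_of_real (expectation (\<lambda>x. U x * sin (T s x)))"
    if [measurable]: "U \<in> borel_measurable M" and U: "\<And>x. 0 \<le> U x" "\<And>x. U x \<le> C" for U s
  proof -
    have "integrable M (\<lambda>x. U x * cos (T s x))" "integrable M (\<lambda>x. U x * sin (T s x))"
      by (rule integrable_const_bound[where B = C],
        use U C in \<open>auto simp: abs_mult intro!: order_trans[OF mult_mono[OF _ abs_cos_le_one]] order_trans[OF mult_mono[OF _ abs_sin_le_one]]\<close>)+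
    moreover have "complex_of_real (U x) * iexp (T s x) =
        complex_of_real (U x * cos (T s x)) + \<i> * complex_of_real (U x * sin (T s x))" for x
      by (simp add: cis_conv_exp[symmetric] complex_eq_iff)
    ultimately show ?thesis by (simp del: of_real_mult)
  qed
  have "expectation (\<lambda>x. complex_of_real (W' x) * iexp (T s x)) =
      complex_of_real (expectation W') * (\<Prod>i\<in>I. \<phi> i (s i))" for s
  proof -
    have "expectation (\<lambda>x. W' x * cos (T s x)) = expectation (\<lambda>x. W x * cos (T s x)) * p"
      using factor_cos[of s 0] by (simp add: W'_def mult_ac)
    \<comment> \<open>The phase \<open>- (pi / 2)\<close> turns the cosine into a sine.\<close>
    moreover have "expectation (\<lambda>x. W' x * sin (T s x)) = expectation (\<lambda>x. W x * sin (T s x)) * p"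
      using factor_cos[of s "- (pi / 2)"] by (simp add: W'_def mult_ac cos_diff)
    ultimately have "expectation (\<lambda>x. complex_of_real (W' x) * iexp (T s x)) =
        expectation (\<lambda>x. complex_of_real (W x) * iexp (T s x)) * p"
      using W' insert.prems(2,3) by (simp add: cis_int algebra_simps)
    also have "expectation (\<lambda>x. complex_of_real (W x) * iexp (T s x)) =
        complex_of_real (expectation W) * (\<Prod>i\<in>I. \<phi> i (s i))"
      using joint[of s 0] by (simp add: \<phi>0)
    finally show ?thesis using factor by (simp add: W'_def[abs_def] mult_ac)
  qed
  then have "expectation (\<lambda>x. W' x * (\<Prod>i\<in>I. indicator (B i) (X i x))) =
      expectation W' * (\<Prod>i\<in>I. prob (X i -` B i \<inter> space M))"
    using W' by (intro insert.IH) (auto simp: T_def \<phi>_def)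
  with insert.hyps factor show ?case by (simp add: W'_def[abs_def] p_def mult_ac)
qed simp

text \<open>It suffices to compare both measures on boxes, where the previous lemma with constant
  weight 1 gives the product formula.\<close>

lemma (in prob_space) distr_PiM_if_char_factors:
  fixes X :: "'i \<Rightarrow> 'a \<Rightarrow> real"
  assumes I: "finite I" and [measurable]: "\<And>i. X i \<in> borel_measurable M"
    and char: "\<And>s. expectation (\<lambda>x. iexp (\<Sum>i\<in>I. s i * X i x)) =
                (\<Prod>i\<in>I. expectation (\<lambda>x. iexp (s i * X i x)))"
  shows "distr M (PiM I (\<lambda>_. borel)) (\<lambda>x. \<lambda>i\<in>I. X i x) = PiM I (\<lambda>i. distr M borel (X i))"
proof (rule product_sigma_finite.PiM_eqI[OF _ I])
  show "product_sigma_finite (\<lambda>i. distr M borel (X i))"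
    unfolding product_sigma_finite_def
    by (intro allI prob_space_imp_sigma_finite prob_space_distr) auto
  show "sets (distr M (PiM I (\<lambda>_. borel)) (\<lambda>x. \<lambda>i\<in>I. X i x)) = sets (PiM I (\<lambda>i. distr M borel (X i)))"
    by (simp cong: sets_PiM_cong)
next
  fix A :: "'i \<Rightarrow> real set" assume A: "\<And>i. i \<in> I \<Longrightarrow> A i \<in> sets (distr M borel (X i))"
  \<comment> \<open>The empty default outside \<open>I\<close> gives measurable sets at all
    indices.\<close>
  define B where "B i = (if i \<in> I then A i else {})" for i
  have [measurable]: "B i \<in> sets borel" for i using A by (simp add: B_def)
  have [measurable]: "(\<lambda>x. \<lambda>i\<in>I. X i x) \<in> measurable M (PiM I (\<lambda>_. borel))"
    by (rule measurable_restrict) simp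
  have eq: "Pi\<^sub>E I A = Pi\<^sub>E I B" by (intro PiE_cong) (simp add: B_def)
  have "expectation (\<lambda>x. 1 * (\<Prod>i\<in>I. indicator (B i) (X i x))) =
      expectation (\<lambda>_. 1) * (\<Prod>i\<in>I. prob (X i -` B i \<inter> space M))"
    using I char by (intro prod_indicator_expectation_if_char_factors[where C = 1]) (auto simp: prob_space)
  moreover have "1 * (\<Prod>i\<in>I. indicator (B i) (X i x)) =
      indicat_real ((\<lambda>x. \<lambda>i\<in>I. X i x) -` Pi\<^sub>E I B \<inter> space M) x" if "x \<in> space M" for x
    using that I by (auto simp: indicator_def PiE_iff prod_zero_iff)
  moreover have "Pi\<^sub>E I B \<in> sets (PiM I (\<lambda>_. borel))" using I by (intro sets_PiM_I_finite) auto
  ultimately have "prob ((\<lambda>x. \<lambda>i\<in>I. X i x) -` Pi\<^sub>E I B \<inter> space M) = (\<Prod>i\<in>I. prob (X i -` B i \<inter> space M))"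
    by (simp add: prob_space cong: Bochner_Integration.integral_cong)
  then show "emeasure (distr M (PiM I (\<lambda>_. borel)) (\<lambda>x. \<lambda>i\<in>I. X i x)) (Pi\<^sub>E I A) =
      (\<Prod>i\<in>I. emeasure (distr M borel (X i)) (A i))"
    unfolding eq using \<open>Pi\<^sub>E I B \<in> _\<close> A
    by (auto simp: emeasure_distr emeasure_eq_measure prod_ennreal[symmetric] B_def intro!: prod.cong)
qed

section \<open>One-dimensional comparisons and their tensorisation\<close>

text \<open>With the other coordinates frozen, the constraint on the sum is a sublevel constraint on
  one coordinate at a shifted threshold. This is why the one-dimensional hypothesis is required for
  every \<open>s\<close>, and why the induction generalises \<open>s\<close>.\<close>

lemma (in product_sigma_finite) nn_integral_sum_squares_le:
  fixes w w' :: "'i \<Rightarrow> 'a \<Rightarrow> ennreal" and g g' :: "'i \<Rightarrow> 'a \<Rightarrow> real"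
  assumes "finite I"
    and [measurable]: "\<And>i. w i \<in> borel_measurable (M i)" "\<And>i. w' i \<in> borel_measurable (M i)"
      "\<And>i. g i \<in> borel_measurable (M i)" "\<And>i. g' i \<in> borel_measurable (M i)"
    and le: "\<And>i s. i \<in> I \<Longrightarrow> (\<integral>\<^sup>+y. w i y * indicator {..s} (g i y) \<partial>M i)
        \<le> c i * (\<integral>\<^sup>+y. w' i y * indicator {..s} (g' i y) \<partial>M i)"
  shows "(\<integral>\<^sup>+x. (\<Prod>i\<in>I. w i (x i)) * indicator {..s} (\<Sum>i\<in>I. g i (x i)) \<partial>PiM I M)
    \<le> (\<Prod>i\<in>I. c i) * (\<integral>\<^sup>+x. (\<Prod>i\<in>I. w' i (x i)) * indicator {..s} (\<Sum>i\<in>I. g' i (x i)) \<partial>PiM I M)"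
  using \<open>finite I\<close> le
proof (induction I arbitrary: s rule: finite_induct)
  case empty
  then show ?case by simp
next
  case (insert j I)
  have meas_prod [measurable]: "(\<lambda>x. \<Prod>i\<in>I. h i (x i)) \<in> borel_measurable (PiM K M)"
    if "\<And>i. h i \<in> borel_measurable (M i)" "I \<subseteq> K" for h :: "'i \<Rightarrow> 'a \<Rightarrow> ennreal" and K
    using that by (intro borel_measurable_prod_ennreal measurable_compose[OF measurable_component_singleton]) auto
  have meas_sum [measurable]: "(\<lambda>x. \<Sum>i\<in>I. h i (x i)) \<in> borel_measurable (PiM K M)"
    if "\<And>i. h i \<in> borel_measurable (M i)" "I \<subseteq> K" for h :: "'i \<Rightarrow> 'a \<Rightarrow> real" and K
    using that by (intro borel_measurable_sum measurable_compose[OF measurable_component_singleton]) auto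
  note [measurable] = meas_prod[OF assms(2) order_refl] meas_prod[OF assms(3) order_refl]
    meas_sum[OF assms(4) order_refl] meas_sum[OF assms(5) order_refl]
    meas_prod[OF assms(2) subset_insertI] meas_prod[OF assms(3) subset_insertI]
    meas_sum[OF assms(4) subset_insertI] meas_sum[OF assms(5) subset_insertI]
  have [measurable]: "(\<lambda>x. x j) \<in> measurable (PiM (insert j I) M) (M j)" by simp
  have upd: "(\<Prod>i\<in>I. h i ((x(j := y)) i)) = (\<Prod>i\<in>I. h i (x i))" for h :: "'i \<Rightarrow> 'a \<Rightarrow> ennreal" and x y
    using insert.hyps by (intro prod.cong) auto
  have upd': "(\<Sum>i\<in>I. h i ((x(j := y)) i)) = (\<Sum>i\<in>I. h i (x i))" for h :: "'i \<Rightarrow> 'a \<Rightarrow> real" and x y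
    using insert.hyps by (intro sum.cong) auto
  have shift: "indicator {..s} (a + b) = (indicator {..s - b} a :: ennreal)" for a b :: real
    by (auto simp: indicator_def)
  let ?F = "\<lambda>x. \<Prod>i\<in>I. w i (x i)" and ?F' = "\<lambda>x. \<Prod>i\<in>I. w' i (x i)"
  let ?S = "\<lambda>x. \<Sum>i\<in>I. g i (x i)" and ?S' = "\<lambda>x. \<Sum>i\<in>I. g' i (x i)"
  have "(\<integral>\<^sup>+x. (\<Prod>i\<in>insert j I. w i (x i)) * indicator {..s} (\<Sum>i\<in>insert j I. g i (x i)) \<partial>PiM (insert j I) M)
      = (\<integral>\<^sup>+x. \<integral>\<^sup>+y. ?F x * (w j y * indicator {..s - ?S x} (g j y)) \<partial>M j \<partial>PiM I M)"
  proof -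
    have "(\<lambda>x. ?F x * (w j (x j) * indicator {..s} (?S x + g j (x j)))) \<in> borel_measurable (PiM (insert j I) M)"
      by measurable
    from product_nn_integral_insert[OF insert.hyps this] show ?thesis
      using insert.hyps
      by (simp add: upd upd' shift add.commute[of _ "g j _"] mult_ac fun_upd_same del: fun_upd_apply)
  qed
  also have "\<dots> = (\<integral>\<^sup>+x. ?F x * (\<integral>\<^sup>+y. w j y * indicator {..s - ?S x} (g j y) \<partial>M j) \<partial>PiM I M)"
    by (intro nn_integral_cong nn_integral_cmult) simp
  \<comment> \<open>One-dimensional hypothesis for coordinate \<open>j\<close>, at the threshold
    left over by the others.\<close>
  also have "\<dots> \<le> (\<integral>\<^sup>+x. ?F x * (c j * (\<integral>\<^sup>+y. w' j y * indicator {..s - ?S x} (g' j y) \<partial>M j)) \<partial>PiM I M)"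
    by (intro nn_integral_mono mult_left_mono insert.prems) auto
  also have "\<dots> = c j * (\<integral>\<^sup>+x. \<integral>\<^sup>+y. ?F x * (w' j y * indicator {..s} (?S x + g' j y)) \<partial>M j \<partial>PiM I M)"
  proof -
    have [measurable]: "(\<lambda>x. \<integral>\<^sup>+y. ?F x * (w' j y * indicator {..s} (?S x + g' j y)) \<partial>M j) \<in> borel_measurable (PiM I M)"
      by measurable
    have "?F x * (c j * (\<integral>\<^sup>+y. w' j y * indicator {..s - ?S x} (g' j y) \<partial>M j)) =
        c j * (\<integral>\<^sup>+y. ?F x * (w' j y * indicator {..s} (?S x + g' j y)) \<partial>M j)" for x
      by (subst nn_integral_cmult) (simp_all add: shift add.commute[of "?S x"] mult_ac)
    then show ?thesis by (simp add: nn_integral_cmult)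
  qed
  also have "(\<integral>\<^sup>+x. \<integral>\<^sup>+y. ?F x * (w' j y * indicator {..s} (?S x + g' j y)) \<partial>M j \<partial>PiM I M) =
      (\<integral>\<^sup>+x. ?F x * (w' j (x j) * indicator {..s} (?S x + g' j (x j))) \<partial>PiM (insert j I) M)"
    using insert.hyps by (subst product_nn_integral_insert) (simp_all add: upd upd' fun_upd_same del: fun_upd_apply)
  \<comment> \<open>Coordinate \<open>j\<close> is moved to the outer integral, so that the
    induction hypothesis applies to the inner one at threshold \<open>s - g' j y\<close>.\<close>
  also have "\<dots> = (\<integral>\<^sup>+y. \<integral>\<^sup>+x. ?F x * (w' j y * indicator {..s} (?S x + g' j y)) \<partial>PiM I M \<partial>M j)"
    using insert.hyps by (subst product_nn_integral_insert_rev) (simp_all add: upd upd' fun_upd_same del: fun_upd_apply)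
  also have "\<dots> = (\<integral>\<^sup>+y. w' j y * (\<integral>\<^sup>+x. ?F x * indicator {..s - g' j y} (?S x) \<partial>PiM I M) \<partial>M j)"
    by (intro nn_integral_cong, subst nn_integral_cmult[symmetric]) (simp_all add: shift mult_ac)
  also have "c j * \<dots> \<le> c j * (\<integral>\<^sup>+y. w' j y * ((\<Prod>i\<in>I. c i) * (\<integral>\<^sup>+x. ?F' x * indicator {..s - g' j y} (?S' x) \<partial>PiM I M)) \<partial>M j)"
    by (intro mult_left_mono nn_integral_mono insert.IH insert.prems) auto
  also have "\<dots> = (\<Prod>i\<in>insert j I. c i) * (\<integral>\<^sup>+y. \<integral>\<^sup>+x. w' j y * (?F' x * indicator {..s} (?S' x + g' j y)) \<partial>PiM I M \<partial>M j)"
  proof -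
    have meas: "(\<lambda>y. \<integral>\<^sup>+x. w' j y * (?F' x * indicator {..s} (?S' x + g' j y)) \<partial>PiM I M) \<in> borel_measurable (M j)"
    proof -
      interpret sigma_finite_measure "PiM I M" using insert.hyps by (intro sigma_finite)
      show ?thesis by measurable
    qed
    have "w' j y * ((\<Prod>i\<in>I. c i) * (\<integral>\<^sup>+x. ?F' x * indicator {..s - g' j y} (?S' x) \<partial>PiM I M)) =
        (\<Prod>i\<in>I. c i) * (\<integral>\<^sup>+x. w' j y * (?F' x * indicator {..s} (?S' x + g' j y)) \<partial>PiM I M)" for y
      by (subst nn_integral_cmult) (simp_all add: shift mult_ac)
    then show ?thesis
      using insert.hyps by (simp only: nn_integral_cmult[OF meas]) (simp add: mult_ac)
  qed
  also have "(\<integral>\<^sup>+y. \<integral>\<^sup>+x. w' j y * (?F' x * indicator {..s} (?S' x + g' j y)) \<partial>PiM I M \<partial>M j) =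
      (\<integral>\<^sup>+x. (\<Prod>i\<in>insert j I. w' i (x i)) * indicator {..s} (\<Sum>i\<in>insert j I. g' i (x i)) \<partial>PiM (insert j I) M)"
    using insert.hyps by (subst product_nn_integral_insert_rev) (simp_all add: upd upd' add.commute mult_ac fun_upd_same del: fun_upd_apply)
  finally show ?case .
qed

lemma nn_integral_lborel_shift:
  fixes f :: "real \<Rightarrow> ennreal"
  assumes "f \<in> borel_measurable borel"
  shows "(\<integral>\<^sup>+y. f y \<partial>lborel) = (\<integral>\<^sup>+y. f (a + y) \<partial>lborel)"
  using nn_integral_real_affine[OF assms, of 1 a] by simp

lemma normal_density_0_antimono:
  "\<bar>x\<bar> \<le> \<bar>y\<bar> \<Longrightarrow> normal_density 0 \<sigma> y \<le> normal_density 0 \<sigma> x"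
  unfolding normal_density_def
  by (intro mult_left_mono) (auto simp: abs_le_square_iff intro!: divide_right_mono)

text \<open>The one-dimensional case of Anderson's inequality.\<close>

lemma normal_interval_le_centred:
  "(\<integral>\<^sup>+y. ennreal (normal_density 0 \<sigma> y) * indicator {..s} ((y - a)\<^sup>2) \<partial>lborel)
    \<le> (\<integral>\<^sup>+y. ennreal (normal_density 0 \<sigma> y) * indicator {..s} (y\<^sup>2) \<partial>lborel)"
proof (cases "s \<ge> 0")
  case True
  define \<rho> where "\<rho> = normal_density 0 \<sigma>"
  have [measurable]: "\<rho> \<in> borel_measurable borel" by (simp add: \<rho>_def)
  define k where "k = \<rho> (sqrt s)"
  have k: "k \<ge> 0" by (simp add: k_def \<rho>_def)
  have nn: "\<rho> y \<ge> 0" for y by (simp add: \<rho>_def)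
  let ?A = "\<lambda>y. indicator {..s} ((y - a)\<^sup>2) :: ennreal"
  let ?B = "\<lambda>y. indicator {..s} (y\<^sup>2) :: ennreal"
  have eq: "(\<integral>\<^sup>+y. ?A y \<partial>lborel) = (\<integral>\<^sup>+y. ?B y \<partial>lborel)"
    by (subst nn_integral_lborel_shift[of _ a]) simp_all
  have "(\<integral>\<^sup>+y. ?B y \<partial>lborel) = (\<integral>\<^sup>+y. indicator {- sqrt s..sqrt s} y \<partial>lborel)"
  proof (rule nn_integral_cong)
    fix y
    have "y\<^sup>2 \<le> s \<longleftrightarrow> \<bar>y\<bar> \<le> sqrt s"
      using True by (metis real_sqrt_abs real_sqrt_le_iff)
    then show "?B y = indicator {- sqrt s..sqrt s} y" by (auto simp: indicator_def abs_le_iff)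
  qed
  then have fin: "(\<integral>\<^sup>+y. ?B y \<partial>lborel) \<noteq> \<infinity>" using True by simp
  have ge: "\<rho> y \<ge> k" if "y\<^sup>2 \<le> s" for y
    unfolding k_def \<rho>_def
    by (rule normal_density_0_antimono) (use that True in \<open>metis abs_of_nonneg real_sqrt_abs real_sqrt_ge_zero real_sqrt_le_iff\<close>)
  have le: "\<rho> y \<le> k" if "\<not> y\<^sup>2 \<le> s" for y
    unfolding k_def \<rho>_def
    by (rule normal_density_0_antimono) (use that True in \<open>metis abs_of_nonneg real_sqrt_abs real_sqrt_ge_zero real_sqrt_le_iff nle_le\<close>)
  \<comment> \<open>Both sets have the same length, and the density is at least \<open>k\<close> exactly on the centred one.\<close>
  have "ennreal (\<rho> y) * ?A y + ennreal k * ?B y \<le> ennreal (\<rho> y) * ?B y + ennreal k * ?A y" for y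
    using ge[of y] le[of y] nn[of y] k
    by (auto simp: indicator_def ennreal_plus[symmetric] simp del: ennreal_plus)
  then have "(\<integral>\<^sup>+y. ennreal (\<rho> y) * ?A y + ennreal k * ?B y \<partial>lborel)
      \<le> (\<integral>\<^sup>+y. ennreal (\<rho> y) * ?B y + ennreal k * ?A y \<partial>lborel)"
    by (rule nn_integral_mono)
  then have "(\<integral>\<^sup>+y. ennreal (\<rho> y) * ?A y \<partial>lborel) + ennreal k * (\<integral>\<^sup>+y. ?B y \<partial>lborel)
      \<le> (\<integral>\<^sup>+y. ennreal (\<rho> y) * ?B y \<partial>lborel) + ennreal k * (\<integral>\<^sup>+y. ?B y \<partial>lborel)"
    by (simp add: nn_integral_add nn_integral_cmult eq)
  \<comment> \<open>Finiteness permits cancelling this common term in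
    \<open>ennreal\<close>.\<close>
  moreover have "ennreal k * (\<integral>\<^sup>+y. ?B y \<partial>lborel) \<noteq> \<infinity>"
    using fin by (simp add: ennreal_mult_eq_top_iff)
  ultimately show ?thesis
    unfolding \<rho>_def[symmetric]
    by (subst (asm) (1 2) add.commute) (auto simp: ennreal_add_left_cancel_le)
next
  case False
  then have "indicator {..s} ((y - a)\<^sup>2) = (0::ennreal)" for y
    by (auto simp: indicator_def) (smt (verit) zero_le_power2)
  then show ?thesis by simp
qed

text \<open>Completing the square, the tilt turns the centred normal law into one with mean
  \<open>\<sigma>\<^sup>2 * u\<close> and mass
  \<open>exp (\<sigma>\<^sup>2 * u\<^sup>2 / 2)\<close>; the interval, wherever it now lies, has at
  most the mass of the centred one.\<close>

lemma normal_tilted_interval_le: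
  assumes "\<sigma> > 0"
  shows "(\<integral>\<^sup>+y. ennreal (exp (u * y)) * indicator {..s} ((y - z)\<^sup>2) \<partial>density lborel (normal_density 0 \<sigma>))
    \<le> ennreal (exp (\<sigma>\<^sup>2 * u\<^sup>2 / 2)) * (\<integral>\<^sup>+y. indicator {..s} (y\<^sup>2) \<partial>density lborel (normal_density 0 \<sigma>))"
proof -
  define \<rho> where "\<rho> = normal_density 0 \<sigma>"
  have [measurable]: "\<rho> \<in> borel_measurable borel" by (simp add: \<rho>_def)
  have nn: "\<rho> y \<ge> 0" for y by (simp add: \<rho>_def)
  define m where "m = \<sigma>\<^sup>2 * u"
  have tilt: "\<rho> (m + y) * exp (u * (m + y)) = exp (\<sigma>\<^sup>2 * u\<^sup>2 / 2) * \<rho> y" for y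
  proof -
    have "- (m + y)\<^sup>2 / (2 * \<sigma>\<^sup>2) + u * (m + y) = \<sigma>\<^sup>2 * u\<^sup>2 / 2 + - y\<^sup>2 / (2 * \<sigma>\<^sup>2)"
      using assms by (simp add: m_def field_simps power2_eq_square)
    then show ?thesis
      unfolding \<rho>_def normal_density_def by (simp add: exp_add[symmetric])
  qed
  have "(\<integral>\<^sup>+y. ennreal (exp (u * y)) * indicator {..s} ((y - z)\<^sup>2) \<partial>density lborel \<rho>) =
      (\<integral>\<^sup>+y. ennreal (\<rho> y * exp (u * y)) * indicator {..s} ((y - z)\<^sup>2) \<partial>lborel)"
    using nn by (subst nn_integral_density) (auto simp: ennreal_mult mult_ac)
  also have "\<dots> = (\<integral>\<^sup>+y. ennreal (\<rho> (m + y) * exp (u * (m + y))) * indicator {..s} ((m + y - z)\<^sup>2) \<partial>lborel)"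
    by (subst nn_integral_lborel_shift[of _ m]) simp_all
  also have "\<dots> = (\<integral>\<^sup>+y. ennreal (exp (\<sigma>\<^sup>2 * u\<^sup>2 / 2)) * (ennreal (\<rho> y) * indicator {..s} ((y - (z - m))\<^sup>2)) \<partial>lborel)"
    unfolding tilt using nn by (intro nn_integral_cong) (simp add: ennreal_mult algebra_simps)
  also have "\<dots> = ennreal (exp (\<sigma>\<^sup>2 * u\<^sup>2 / 2)) * (\<integral>\<^sup>+y. ennreal (\<rho> y) * indicator {..s} ((y - (z - m))\<^sup>2) \<partial>lborel)"
    by (subst nn_integral_cmult) simp_all
  also have "\<dots> \<le> ennreal (exp (\<sigma>\<^sup>2 * u\<^sup>2 / 2)) * (\<integral>\<^sup>+y. ennreal (\<rho> y) * indicator {..s} (y\<^sup>2) \<partial>lborel)"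
    unfolding \<rho>_def by (intro mult_left_mono normal_interval_le_centred) simp
  also have "(\<integral>\<^sup>+y. ennreal (\<rho> y) * indicator {..s} (y\<^sup>2) \<partial>lborel) = (\<integral>\<^sup>+y. indicator {..s} (y\<^sup>2) \<partial>density lborel \<rho>)"
    by (subst nn_integral_density) auto
  finally show ?thesis by (simp add: \<rho>_def)
qed

text \<open>The centred interval is symmetric, so the density shifted by \<open>h\<close> may be
  averaged over \<open>y\<close> and \<open>- y\<close>. The cross terms then combine to a
  hyperbolic cosine, which is at least 1, and only the Cameron-Martin factor remains.\<close>

lemma normal_centred_interval_le:
  assumes "\<sigma> > 0"
  shows "(\<integral>\<^sup>+y. indicator {..s} (y\<^sup>2) \<partial>density lborel (normal_density 0 \<sigma>))
    \<le> ennreal (exp (h\<^sup>2 / (2 * \<sigma>\<^sup>2))) * (\<integral>\<^sup>+y. indicator {..s} ((y - h)\<^sup>2) \<partial>density lborel (normal_density 0 \<sigma>))"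
proof -
  define \<rho> where "\<rho> = normal_density 0 \<sigma>"
  have [measurable]: "\<rho> \<in> borel_measurable borel" by (simp add: \<rho>_def)
  have nn: "\<rho> y \<ge> 0" for y by (simp add: \<rho>_def)
  define c where "c = exp (h\<^sup>2 / (2 * \<sigma>\<^sup>2))"
  let ?B = "\<lambda>y. indicator {..s} (y\<^sup>2) :: ennreal"
  have sym: "2 * \<rho> y \<le> c * \<rho> (h + y) + c * \<rho> (h + - y)" for y
  proof -
    have shifted: "c * \<rho> (h + x) = \<rho> x * exp (- (h * x / \<sigma>\<^sup>2))" for x
    proof -
      have "h\<^sup>2 / (2 * \<sigma>\<^sup>2) + - (h + x)\<^sup>2 / (2 * \<sigma>\<^sup>2) = - x\<^sup>2 / (2 * \<sigma>\<^sup>2) + - (h * x / \<sigma>\<^sup>2)"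
        using assms by (simp add: field_simps power2_eq_square)
      then show ?thesis
        unfolding \<rho>_def normal_density_def c_def by (simp add: exp_add[symmetric])
    qed
    have "\<rho> (- y) = \<rho> y" by (simp add: \<rho>_def normal_density_def)
    define t where "t = h * y / \<sigma>\<^sup>2"
    have "2 \<le> exp (- t) + exp t"
      using exp_ge_add_one_self[of t] exp_ge_add_one_self[of "- t"] by linarith
    then have "\<rho> y * 2 \<le> \<rho> y * (exp (- t) + exp t)" by (intro mult_left_mono nn)
    then show ?thesis
      unfolding shifted using \<open>\<rho> (- y) = \<rho> y\<close> by (simp add: t_def algebra_simps)
  qed
  define Q where "Q = (\<integral>\<^sup>+y. ennreal (\<rho> (h + y)) * ?B y \<partial>lborel)"
  have Q_neg: "(\<integral>\<^sup>+y. ennreal (\<rho> (h + - y)) * ?B y \<partial>lborel) = Q"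
    unfolding Q_def by (subst (2) nn_integral_real_affine[where c = "-1" and t = 0]) simp_all
  have "2 * (\<integral>\<^sup>+y. ennreal (\<rho> y) * ?B y \<partial>lborel) = (\<integral>\<^sup>+y. ennreal (2 * \<rho> y) * ?B y \<partial>lborel)"
    by (subst nn_integral_cmult[symmetric]) (simp_all add: ennreal_mult' mult.assoc)
  also have "\<dots> \<le> (\<integral>\<^sup>+y. ennreal c * (ennreal (\<rho> (h + y)) * ?B y) + ennreal c * (ennreal (\<rho> (h + - y)) * ?B y) \<partial>lborel)"
  proof (rule nn_integral_mono)
    fix y
    have "ennreal (2 * \<rho> y) \<le> ennreal (c * \<rho> (h + y) + c * \<rho> (h + - y))"
      by (intro ennreal_leI sym)
    also have "\<dots> = ennreal c * ennreal (\<rho> (h + y)) + ennreal c * ennreal (\<rho> (h + - y))"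
      using nn by (simp add: c_def ennreal_plus ennreal_mult)
    finally show "ennreal (2 * \<rho> y) * ?B y \<le> ennreal c * (ennreal (\<rho> (h + y)) * ?B y) + ennreal c * (ennreal (\<rho> (h + - y)) * ?B y)"
      by (auto simp: indicator_def)
  qed
  also have "\<dots> = ennreal c * Q + ennreal c * Q"
    by (subst nn_integral_add) (simp_all add: nn_integral_cmult Q_neg[simplified] Q_def[symmetric])
  also have "\<dots> = 2 * (ennreal c * Q)" by (simp add: mult_2)
  finally have le: "(\<integral>\<^sup>+y. ennreal (\<rho> y) * ?B y \<partial>lborel) \<le> ennreal c * Q"
    by (subst (asm) ennreal_mult_le_mult_iff) auto
  have "Q = (\<integral>\<^sup>+y. ennreal (\<rho> y) * indicator {..s} ((y - h)\<^sup>2) \<partial>lborel)"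
    unfolding Q_def by (subst (2) nn_integral_lborel_shift[of _ h]) simp_all
  with le show ?thesis
    unfolding c_def \<rho>_def by (simp add: nn_integral_density)
qed

section \<open>Ball probabilities\<close>

text \<open>Legendre duality between \<open>q u / 2\<close> and half the squared Cameron-Martin
  norm, in the direction that also yields membership in the space.\<close>

lemma (in gaussian_hilbert) cm_space_and_norm_le:
  assumes "\<And>u. u \<bullet> z - q u / 2 \<le> K"
  shows "z \<in> cm_space \<mu>" and "(cm_norm \<mu> z)\<^sup>2 / 2 \<le> K"
proof -
  have K: "K \<ge> 0" using assms[of 0] by simp
  have le: "t \<le> sqrt (2 * K)" if t: "t \<in> cm_values \<mu> z" for t
  proof -
    obtain u where u: "t = u \<bullet> z" "q u \<le> 1" using t by (auto simp: cm_values_eq)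
    \<comment> \<open>The test vector is \<open>u\<close> scaled by its own value
      \<open>t = u \<bullet> z\<close>, which is the optimal multiple when
      \<open>q u = 1\<close>.\<close>
    have "t\<^sup>2 - t\<^sup>2 * q u / 2 \<le> K"
      using assms[of "t *\<^sub>R u"] by (simp add: q_scaleR u(1) power2_eq_square)
    moreover have "t\<^sup>2 * q u \<le> t\<^sup>2 * 1" using u by (intro mult_left_mono) auto
    ultimately have "t\<^sup>2 \<le> 2 * K" by argo
    then show ?thesis by (rule real_le_rsqrt)
  qed
  then show "z \<in> cm_space \<mu>" unfolding cm_space_def by (auto intro!: bdd_aboveI)
  have "0 \<in> cm_values \<mu> z" by (auto simp: cm_values_eq intro!: exI[of _ 0])
  then have "0 \<le> cm_norm \<mu> z" "cm_norm \<mu> z \<le> sqrt (2 * K)"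
    unfolding cm_norm_def by (intro cSup_upper cSup_least le bdd_aboveI[OF le], auto)+
  then have "(cm_norm \<mu> z)\<^sup>2 \<le> (sqrt (2 * K))\<^sup>2" by (rule power_mono[rotated])
  with K show "(cm_norm \<mu> z)\<^sup>2 / 2 \<le> K" by simp
qed

lemma (in gaussian_hilbert) inner_le_cm_norm:
  assumes "z \<in> cm_space \<mu>" "q u \<le> 1"
  shows "u \<bullet> z \<le> cm_norm \<mu> z"
  unfolding cm_norm_def using assms by (intro cSup_upper) (auto simp: cm_space_def cm_values_eq)

section \<open>Independent coordinates and cylinder estimates\<close>

context gaussian_hilbert_basis
begin

text \<open>A linear combination of the coordinates is again an inner product, with characteristic
  function determined by \<open>q\<close>; by \<open>q_sum\<close> the exponent is a sum without
  mixed terms.\<close>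

lemma distr_coordinates:
  "distr \<mu> (PiM {..<n} (\<lambda>_. borel)) (\<lambda>x. \<lambda>i\<in>{..<n}. v i \<bullet> x) = PiM {..<n} (\<lambda>i. distr \<mu> borel (\<lambda>x. v i \<bullet> x))"
proof (rule distr_PiM_if_char_factors)
  fix s :: "nat \<Rightarrow> real"
  have "expectation (\<lambda>x. iexp (\<Sum>i<n. s i * (v i \<bullet> x))) = expectation (\<lambda>x. iexp (1 * ((\<Sum>i<n. s i *\<^sub>R v i) \<bullet> x)))"
    by (simp add: inner_sum_left)
  also have "\<dots> = complex_of_real (\<Prod>i<n. exp (- (s i)\<^sup>2 * q (v i) / 2))"
    unfolding char_inner by (simp add: q_sum exp_sum[symmetric] sum_negf sum_divide_distrib)
  also have "\<dots> = (\<Prod>i<n. expectation (\<lambda>x. iexp (s i * (v i \<bullet> x))))"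
    unfolding char_inner by simp
  finally show "expectation (\<lambda>x. iexp (\<Sum>i<n. s i * (v i \<bullet> x))) = (\<Prod>i<n. expectation (\<lambda>x. iexp (s i * (v i \<bullet> x))))" .
qed auto

lemma P_measurable [measurable]: "P n \<in> borel_measurable borel"
  unfolding P_def by measurable

text \<open>Carries the tensorised inequality over to \<open>\<mu>\<close>. The \<open>w\<close> are
  the coordinate factors of a tilt, the \<open>g\<close> the coordinate contributions to a squared
  distance.\<close>

lemma cylinder_transfer:
  fixes w w' :: "nat \<Rightarrow> real \<Rightarrow> ennreal" and g g' :: "nat \<Rightarrow> real \<Rightarrow> real"
  assumes [measurable]: "\<And>i. w i \<in> borel_measurable borel" "\<And>i. w' i \<in> borel_measurable borel"
      "\<And>i. g i \<in> borel_measurable borel" "\<And>i. g' i \<in> borel_measurable borel"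
    and le: "\<And>i s. i < n \<Longrightarrow> (\<integral>\<^sup>+x. w i (v i \<bullet> x) * indicator {..s} (g i (v i \<bullet> x)) \<partial>\<mu>)
        \<le> c i * (\<integral>\<^sup>+x. w' i (v i \<bullet> x) * indicator {..s} (g' i (v i \<bullet> x)) \<partial>\<mu>)"
  shows "(\<integral>\<^sup>+x. (\<Prod>i<n. w i (v i \<bullet> x)) * indicator {..s} (\<Sum>i<n. g i (v i \<bullet> x)) \<partial>\<mu>)
    \<le> (\<Prod>i<n. c i) * (\<integral>\<^sup>+x. (\<Prod>i<n. w' i (v i \<bullet> x)) * indicator {..s} (\<Sum>i<n. g' i (v i \<bullet> x)) \<partial>\<mu>)"
proof -
  interpret product_sigma_finite "\<lambda>i. distr \<mu> borel (\<lambda>x. v i \<bullet> x)"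
    unfolding product_sigma_finite_def
    by (intro allI prob_space_imp_sigma_finite prob_space_distr) auto
  have [measurable]: "(\<lambda>x. \<lambda>i\<in>{..<n}. v i \<bullet> x) \<in> measurable \<mu> (PiM {..<n} (\<lambda>_. borel))"
    by (rule measurable_restrict) simp
  have transfer: "(\<integral>\<^sup>+x. (\<Prod>i<n. w i (v i \<bullet> x)) * indicator {..s} (\<Sum>i<n. g i (v i \<bullet> x)) \<partial>\<mu>) =
      (\<integral>\<^sup>+x. (\<Prod>i<n. w i (x i)) * indicator {..s} (\<Sum>i<n. g i (x i)) \<partial>PiM {..<n} (\<lambda>i. distr \<mu> borel (\<lambda>x. v i \<bullet> x)))"
    if [measurable]: "\<And>i. w i \<in> borel_measurable borel" "\<And>i. g i \<in> borel_measurable borel"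
    for w :: "nat \<Rightarrow> real \<Rightarrow> ennreal" and g :: "nat \<Rightarrow> real \<Rightarrow> real"
    unfolding distr_coordinates[symmetric] by (subst nn_integral_distr) auto
  show ?thesis
    unfolding transfer[OF assms(1,3)] transfer[OF assms(2,4)]
  proof (rule nn_integral_sum_squares_le)
    fix i s assume "i \<in> {..<n}"
    then show "(\<integral>\<^sup>+y. w i y * indicator {..s} (g i y) \<partial>distr \<mu> borel (\<lambda>x. v i \<bullet> x))
        \<le> c i * (\<integral>\<^sup>+y. w' i y * indicator {..s} (g' i y) \<partial>distr \<mu> borel (\<lambda>x. v i \<bullet> x))"
      using le[of i s] by (subst (1 2) nn_integral_distr) auto
  qed auto
qed

lemma nn_integral_marginal:
  assumes [measurable]: "f \<in> borel_measurable borel" and "v i \<noteq> 0"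
  shows "(\<integral>\<^sup>+x. f (v i \<bullet> x) \<partial>\<mu>) = (\<integral>\<^sup>+y. f y \<partial>density lborel (normal_density 0 (sqrt (q (v i)))))"
  unfolding distr_inner[OF assms(2), symmetric] by (subst nn_integral_distr) auto

text \<open>Both the tilt and the squared distance split over the coordinates, and the coordinate
  factors multiply to \<open>exp (q (P n u) / 2)\<close> by \<open>q_sum\<close>.\<close>

lemma cylinder_upper:
  "(\<integral>\<^sup>+x. ennreal (exp (P n u \<bullet> x)) * indicator {..s} ((norm (P n (x - z)))\<^sup>2) \<partial>\<mu>)
    \<le> ennreal (exp (q (P n u) / 2)) * (\<integral>\<^sup>+x. indicator {..s} ((norm (P n x))\<^sup>2) \<partial>\<mu>)"
proof -
  have "(\<integral>\<^sup>+x. (\<Prod>i<n. ennreal (exp ((v i \<bullet> u) * (v i \<bullet> x)))) * indicator {..s} (\<Sum>i<n. (v i \<bullet> x - v i \<bullet> z)\<^sup>2) \<partial>\<mu>)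
      \<le> (\<Prod>i<n. ennreal (exp (q (v i) * (v i \<bullet> u)\<^sup>2 / 2))) * (\<integral>\<^sup>+x. (\<Prod>i<n. 1) * indicator {..s} (\<Sum>i<n. (v i \<bullet> x)\<^sup>2) \<partial>\<mu>)"
  proof (rule cylinder_transfer)
    fix i s
    show "(\<integral>\<^sup>+x. ennreal (exp ((v i \<bullet> u) * (v i \<bullet> x))) * indicator {..s} ((v i \<bullet> x - v i \<bullet> z)\<^sup>2) \<partial>\<mu>)
        \<le> ennreal (exp (q (v i) * (v i \<bullet> u)\<^sup>2 / 2)) * (\<integral>\<^sup>+x. 1 * indicator {..s} ((v i \<bullet> x)\<^sup>2) \<partial>\<mu>)"
    proof (cases "v i = 0")
      case False
      then show ?thesis
        using normal_tilted_interval_le[of "sqrt (q (v i))" "v i \<bullet> u" s "v i \<bullet> z"] q_pos[OF False]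
        by (simp add: nn_integral_marginal[OF _ False, of "\<lambda>y. ennreal (exp ((v i \<bullet> u) * y)) * indicator {..s} ((y - v i \<bullet> z)\<^sup>2)"]
            nn_integral_marginal[OF _ False, of "\<lambda>y. indicator {..s} (y\<^sup>2)"])
    qed simp
  qed auto
  moreover have "(\<Prod>i<n. ennreal (exp ((v i \<bullet> u) * (v i \<bullet> x)))) = ennreal (exp (P n u \<bullet> x))" for x
    by (simp add: prod_ennreal exp_sum[symmetric] P_def inner_sum_left)
  moreover have "(\<Prod>i<n. ennreal (exp (q (v i) * (v i \<bullet> u)\<^sup>2 / 2))) = ennreal (exp (q (P n u) / 2))"
    by (simp add: prod_ennreal exp_sum[symmetric] P_def q_sum sum_divide_distrib mult.commute)
  ultimately show ?thesis by (simp add: norm_P inner_diff_right)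
qed

text \<open>For \<open>v i = 0\<close> the summand below is \<open>0 / 0 = 0\<close>.\<close>

lemma cylinder_lower:
  "(\<integral>\<^sup>+x. indicator {..s} ((norm (P n x))\<^sup>2) \<partial>\<mu>)
    \<le> ennreal (exp ((\<Sum>i<n. (v i \<bullet> h)\<^sup>2 / q (v i)) / 2)) * (\<integral>\<^sup>+x. indicator {..s} ((norm (P n (x - h)))\<^sup>2) \<partial>\<mu>)"
proof -
  have "(\<integral>\<^sup>+x. (\<Prod>i<n. 1) * indicator {..s} (\<Sum>i<n. (v i \<bullet> x)\<^sup>2) \<partial>\<mu>)
      \<le> (\<Prod>i<n. ennreal (exp ((v i \<bullet> h)\<^sup>2 / (2 * q (v i))))) * (\<integral>\<^sup>+x. (\<Prod>i<n. 1) * indicator {..s} (\<Sum>i<n. (v i \<bullet> x - v i \<bullet> h)\<^sup>2) \<partial>\<mu>)"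
  proof (rule cylinder_transfer)
    fix i s
    show "(\<integral>\<^sup>+x. 1 * indicator {..s} ((v i \<bullet> x)\<^sup>2) \<partial>\<mu>)
        \<le> ennreal (exp ((v i \<bullet> h)\<^sup>2 / (2 * q (v i)))) * (\<integral>\<^sup>+x. 1 * indicator {..s} ((v i \<bullet> x - v i \<bullet> h)\<^sup>2) \<partial>\<mu>)"
    proof (cases "v i = 0")
      case False
      then show ?thesis
        using normal_centred_interval_le[of "sqrt (q (v i))" s "v i \<bullet> h"] q_pos[OF False]
        by (simp add: nn_integral_marginal[OF _ False, of "\<lambda>y. indicator {..s} ((y - v i \<bullet> h)\<^sup>2)"]
            nn_integral_marginal[OF _ False, of "\<lambda>y. indicator {..s} (y\<^sup>2)"])
    qed simp
  qed auto
  moreover have "(\<Prod>i<n. ennreal (exp ((v i \<bullet> h)\<^sup>2 / (2 * q (v i))))) =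
      ennreal (exp ((\<Sum>i<n. (v i \<bullet> h)\<^sup>2 / q (v i)) / 2))"
    by (simp add: prod_ennreal exp_sum[symmetric] sum_divide_distrib field_simps)
  ultimately show ?thesis by (simp add: norm_P inner_diff_right)
qed

section \<open>From cylinders to balls\<close>

definition cyl :: "nat \<Rightarrow> 'a \<Rightarrow> real \<Rightarrow> 'a set" where
  "cyl n z r = {x. norm (P n (x - z)) \<le> r}"

lemma cyl_sets [measurable]: "cyl n z r \<in> sets borel"
proof -
  have "{x \<in> space borel. norm (P n (x - z)) \<le> r} \<in> sets borel" by measurable
  then show ?thesis by (simp add: cyl_def)
qed

lemma indicator_cyl:
  "r \<ge> 0 \<Longrightarrow> indicator {..r\<^sup>2} ((norm (P n (x - z)))\<^sup>2) = (indicator (cyl n z r) x :: ennreal)"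
  by (auto simp: indicator_def cyl_def power2_le_iff_abs_le)

lemma norm_P_mono: "m \<le> n \<Longrightarrow> norm (P m x) \<le> norm (P n x)"
proof -
  assume "m \<le> n"
  then have "(norm (P m x))\<^sup>2 \<le> (norm (P n x))\<^sup>2"
    unfolding norm_P by (intro sum_mono2) auto
  then show ?thesis by (simp add: power2_le_iff_abs_le)
qed

lemma norm_P_le: "norm (P n x) \<le> norm x"
  using bessel[of x n] by (simp add: norm_P[symmetric] power2_le_iff_abs_le)

text \<open>The condition defining \<open>cyl\<close> is closed, so the cylinders decrease to the
  closed ball; open balls are recovered later as increasing unions of closed ones.\<close>

lemma prob_cyl_tendsto: "(\<lambda>n. prob (cyl n z r)) \<longlonglongrightarrow> prob (cball z r)"
proof -
  have "(\<Inter>n. cyl n z r) = cball z r"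
  proof (intro set_eqI iffI)
    fix x assume "x \<in> (\<Inter>n. cyl n z r)"
    then have "norm (x - z) \<le> r"
      by (intro LIMSEQ_le_const2[OF tendsto_norm[OF P_tendsto]]) (auto simp: cyl_def)
    then show "x \<in> cball z r" by (simp add: dist_norm norm_minus_commute)
  next
    fix x assume "x \<in> cball z r"
    then have "norm (x - z) \<le> r" by (simp add: dist_norm norm_minus_commute)
    then show "x \<in> (\<Inter>n. cyl n z r)"
      using norm_P_le[of _ "x - z"] order_trans by (auto simp: cyl_def)
  qed
  moreover have "decseq (\<lambda>n. cyl n z r)"
    unfolding decseq_def cyl_def using norm_P_mono order_trans by blast
  ultimately show ?thesis
    using finite_Lim_measure_decseq[of "\<lambda>n. cyl n z r"] cyl_sets by (simp add: image_subset_iff)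
qed

lemma P_selfadjoint: "P n u \<bullet> x = P n u \<bullet> P n x"
  unfolding P_def[of n u] inner_sum_left by (intro sum.cong) (auto simp: v_inner_P)

lemma prob_cball_upper:
  assumes "r \<ge> 0"
  shows "exp (u \<bullet> z - norm u * r) * prob (cball z r) \<le> exp (q u / 2) * prob (cball 0 r)"
proof (rule LIMSEQ_le)
  show "(\<lambda>n. exp (P n u \<bullet> z - norm u * r) * prob (cyl n z r)) \<longlonglongrightarrow> exp (u \<bullet> z - norm u * r) * prob (cball z r)"
    by (intro tendsto_intros P_tendsto prob_cyl_tendsto)
  have "(\<lambda>n. q (P n u)) \<longlonglongrightarrow> q u"
    by (intro q_weakly_continuous tendsto_intros P_tendsto)
  then show "(\<lambda>n. exp (q (P n u) / 2) * prob (cyl n 0 r)) \<longlonglongrightarrow> exp (q u / 2) * prob (cball 0 r)"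
    by (intro tendsto_intros prob_cyl_tendsto) auto
  have "exp (P n u \<bullet> z - norm u * r) * prob (cyl n z r) \<le> exp (q (P n u) / 2) * prob (cyl n 0 r)" for n
  proof -
    \<comment> \<open>By Cauchy-Schwarz the tilt on the cylinder falls below its value at the centre
      by a factor of at most \<open>exp (norm u * r)\<close>.\<close>
    have le: "ennreal (exp (P n u \<bullet> z - norm u * r)) * indicator (cyl n z r) x
        \<le> ennreal (exp (P n u \<bullet> x)) * indicator (cyl n z r) x" for x
    proof (cases "x \<in> cyl n z r")
      case True
      have "- (P n u \<bullet> (x - z)) \<le> norm (P n u) * norm (P n (x - z))"
        unfolding P_selfadjoint[of n u "x - z"]
        using Cauchy_Schwarz_ineq2[of "P n u" "P n (x - z)"] by linarith
      also have "\<dots> \<le> norm u * r"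
        using True norm_P_le by (intro mult_mono) (auto simp: cyl_def)
      finally have "P n u \<bullet> z - norm u * r \<le> P n u \<bullet> x" by (simp add: inner_diff_right)
      with True show ?thesis by (simp add: ennreal_leI)
    qed simp
    have "ennreal (exp (P n u \<bullet> z - norm u * r) * prob (cyl n z r)) =
        (\<integral>\<^sup>+x. ennreal (exp (P n u \<bullet> z - norm u * r)) * indicator (cyl n z r) x \<partial>\<mu>)"
      by (subst nn_integral_cmult) (auto simp: emeasure_eq_measure ennreal_mult)
    also have "\<dots> \<le> (\<integral>\<^sup>+x. ennreal (exp (P n u \<bullet> x)) * indicator (cyl n z r) x \<partial>\<mu>)"
      by (intro nn_integral_mono le)
    also have "\<dots> \<le> ennreal (exp (q (P n u) / 2)) * (\<integral>\<^sup>+x. indicator (cyl n 0 r) x \<partial>\<mu>)"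
      using cylinder_upper[of n u "r\<^sup>2" z] indicator_cyl[OF assms, of n _ z] indicator_cyl[OF assms, of n _ 0]
      by simp
    also have "\<dots> = ennreal (exp (q (P n u) / 2) * prob (cyl n 0 r))"
      by (simp add: emeasure_eq_measure ennreal_mult)
    finally show ?thesis by (simp add: ennreal_le_iff)
  qed
  then show "\<exists>N. \<forall>n\<ge>N. exp (P n u \<bullet> z - norm u * r) * prob (cyl n z r) \<le> exp (q (P n u) / 2) * prob (cyl n 0 r)"
    by blast
qed

lemma sum_squares_le_cm_norm:
  assumes "h \<in> cm_space \<mu>"
  shows "(\<Sum>i<n. (v i \<bullet> h)\<^sup>2 / q (v i)) \<le> (cm_norm \<mu> h)\<^sup>2"
proof -
  define S where "S = (\<Sum>i<n. (v i \<bullet> h)\<^sup>2 / q (v i))"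
  have S: "S \<ge> 0" unfolding S_def by (intro sum_nonneg) (simp add: q_nonneg)
  show ?thesis
  proof (cases "S = 0")
    case False
    with S have S: "S > 0" by simp
    \<comment> \<open>The inverse covariance applied to the truncation of \<open>h\<close>: it makes
      \<open>q u\<close> and \<open>u \<bullet> h\<close> both equal to \<open>S\<close>, so
      dividing by \<open>sqrt S\<close> gives a functional of variance 1 with value
      \<open>sqrt S\<close>. Terms with \<open>v i = 0\<close> vanish.\<close>
    define u where "u = (\<Sum>i<n. ((v i \<bullet> h) / q (v i)) *\<^sub>R v i)"
    have "q u = S"
      unfolding u_def S_def by (subst q_sum) (auto intro!: sum.cong simp: power2_eq_square)
    moreover have "u \<bullet> h = S"
      unfolding u_def S_def by (simp add: inner_sum_left power2_eq_square)
    ultimately have "S / sqrt S \<le> cm_norm \<mu> h"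
      using inner_le_cm_norm[OF assms, of "(1 / sqrt S) *\<^sub>R u"] S by (simp add: q_scaleR power_divide)
    then have "sqrt S \<le> cm_norm \<mu> h" by (simp add: real_div_sqrt S less_imp_le)
    then have "(sqrt S)\<^sup>2 \<le> (cm_norm \<mu> h)\<^sup>2" by (rule power_mono) (use S in simp)
    then show ?thesis using S by (simp add: S_def)
  qed (simp add: S_def)
qed

lemma prob_cball_lower:
  assumes "h \<in> cm_space \<mu>" "r \<ge> 0"
  shows "prob (cball 0 r) \<le> exp ((cm_norm \<mu> h)\<^sup>2 / 2) * prob (cball h r)"
proof (rule LIMSEQ_le)
  show "(\<lambda>n. prob (cyl n 0 r)) \<longlonglongrightarrow> prob (cball 0 r)" by (rule prob_cyl_tendsto)
  show "(\<lambda>n. exp ((cm_norm \<mu> h)\<^sup>2 / 2) * prob (cyl n h r)) \<longlonglongrightarrow> exp ((cm_norm \<mu> h)\<^sup>2 / 2) * prob (cball h r)"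
    by (intro tendsto_intros prob_cyl_tendsto)
  have "prob (cyl n 0 r) \<le> exp ((cm_norm \<mu> h)\<^sup>2 / 2) * prob (cyl n h r)" for n
  proof -
    have "ennreal (prob (cyl n 0 r)) = (\<integral>\<^sup>+x. indicator (cyl n 0 r) x \<partial>\<mu>)"
      by (simp add: emeasure_eq_measure)
    also have "\<dots> \<le> ennreal (exp ((\<Sum>i<n. (v i \<bullet> h)\<^sup>2 / q (v i)) / 2)) * (\<integral>\<^sup>+x. indicator (cyl n h r) x \<partial>\<mu>)"
      using cylinder_lower[of "r\<^sup>2" n h] indicator_cyl[OF assms(2), of n _ h] indicator_cyl[OF assms(2), of n _ 0]
      by simp
    also have "\<dots> \<le> ennreal (exp ((cm_norm \<mu> h)\<^sup>2 / 2)) * (\<integral>\<^sup>+x. indicator (cyl n h r) x \<partial>\<mu>)"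
      using sum_squares_le_cm_norm[OF assms(1), of n] by (intro mult_right_mono ennreal_leI) auto
    also have "\<dots> = ennreal (exp ((cm_norm \<mu> h)\<^sup>2 / 2) * prob (cyl n h r))"
      by (simp add: emeasure_eq_measure ennreal_mult)
    finally show ?thesis by (simp add: ennreal_le_iff)
  qed
  then show "\<exists>N. \<forall>n\<ge>N. prob (cyl n 0 r) \<le> exp ((cm_norm \<mu> h)\<^sup>2 / 2) * prob (cyl n h r)"
    by blast
qed

lemma prob_ball_le_if_cball_le:
  assumes "\<delta> > 0" "C \<ge> 0"
    and le: "\<And>r. 0 \<le> r \<Longrightarrow> r < \<delta> \<Longrightarrow> prob (cball z r) \<le> C * prob (cball y r)"
  shows "prob (ball z \<delta>) \<le> C * prob (ball y \<delta>)"
proof -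
  \<comment> \<open>Radii in \<open>[0, \<delta>)\<close> increasing to \<open>\<delta>\<close>,
    starting at 0.\<close>
  define r where "r n = \<delta> - \<delta> / real (Suc n)" for n
  have r: "0 \<le> r n" "r n < \<delta>" for n using \<open>\<delta> > 0\<close> by (auto simp: r_def field_simps)
  have "(\<lambda>n. \<delta> - \<delta> * (1 / real (Suc n))) \<longlonglongrightarrow> \<delta> - \<delta> * 0"
    by (intro tendsto_intros LIMSEQ_Suc lim_1_over_n)
  then have r_lim: "r \<longlonglongrightarrow> \<delta>" by (simp add: r_def[abs_def])
  have "incseq (\<lambda>n. cball z (r n))"
  proof (rule incseq_SucI)
    fix n
    have "\<delta> / real (Suc (Suc n)) \<le> \<delta> / real (Suc n)"
      using \<open>\<delta> > 0\<close> by (intro divide_left_mono) auto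
    then show "cball z (r n) \<subseteq> cball z (r (Suc n))" by (intro subset_cball) (simp add: r_def)
  qed
  moreover have "(\<Union>n. cball z (r n)) = ball z \<delta>"
  proof (intro set_eqI iffI)
    fix x assume "x \<in> ball z \<delta>"
    then have "eventually (\<lambda>n. dist z x < r n) sequentially"
      using order_tendstoD(1)[OF r_lim] by simp
    then show "x \<in> (\<Union>n. cball z (r n))"
      by (auto simp: eventually_sequentially intro: less_imp_le)
  next
    fix x assume "x \<in> (\<Union>n. cball z (r n))"
    then show "x \<in> ball z \<delta>" using r(2) by (auto intro: le_less_trans)
  qed
  ultimately have "(\<lambda>n. prob (cball z (r n))) \<longlonglongrightarrow> prob (ball z \<delta>)"
    using finite_Lim_measure_incseq[of "\<lambda>n. cball z (r n)"] by (simp add: image_subset_iff)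
  moreover have "prob (cball z (r n)) \<le> C * prob (ball y \<delta>)" for n
  proof -
    have "prob (cball y (r n)) \<le> prob (ball y \<delta>)"
      using r[of n] by (intro finite_measure_mono) auto
    then show ?thesis using le[OF r, of n] \<open>C \<ge> 0\<close> by (meson mult_left_mono order_trans)
  qed
  ultimately show ?thesis by (intro LIMSEQ_le_const2) auto
qed

lemma prob_ball_upper:
  assumes "\<delta> > 0"
  shows "exp (u \<bullet> z - norm u * \<delta>) * prob (ball z \<delta>) \<le> exp (q u / 2) * prob (ball 0 \<delta>)"
proof -
  let ?a = "exp (u \<bullet> z - norm u * \<delta>)"
  have "prob (ball z \<delta>) \<le> (exp (q u / 2) / ?a) * prob (ball 0 \<delta>)"
  proof (rule prob_ball_le_if_cball_le)
    fix r assume r: "0 \<le> r" "r < \<delta>"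
    have "?a \<le> exp (u \<bullet> z - norm u * r)"
      using r by (simp add: mult_left_mono)
    then have "?a * prob (cball z r) \<le> exp (q u / 2) * prob (cball 0 r)"
      using prob_cball_upper[OF r(1), of u z]
      by (meson measure_nonneg mult_right_mono order_trans)
    then show "prob (cball z r) \<le> (exp (q u / 2) / ?a) * prob (cball 0 r)"
      by (simp add: field_simps)
  qed (use assms in auto)
  then show ?thesis by (simp add: field_simps)
qed

lemma prob_ball_lower:
  assumes "h \<in> cm_space \<mu>" "\<delta> > 0"
  shows "exp (- (cm_norm \<mu> h)\<^sup>2 / 2) * prob (ball 0 \<delta>) \<le> prob (ball h \<delta>)"
proof -
  have "prob (ball 0 \<delta>) \<le> exp ((cm_norm \<mu> h)\<^sup>2 / 2) * prob (ball h \<delta>)"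
    using assms by (intro prob_ball_le_if_cball_le prob_cball_lower) auto
  then show ?thesis by (simp add: exp_minus field_simps)
qed

section \<open>Positivity of balls at the origin and compactness of centres\<close>

lemma prob_ball_0_pos:
  assumes "\<delta> > 0"
  shows "prob (ball 0 \<delta>) > 0"
proof (rule ccontr)
  assume "\<not> prob (ball 0 \<delta>) > 0"
  then have "prob (ball 0 \<delta>) = 0" using measure_nonneg[of \<mu> "ball 0 \<delta>"] by linarith
  \<comment> \<open>With \<open>u = 0\<close> the upper bound says that no ball outweighs the
    centred one; a null centred ball would make a countable cover of the space null.\<close>
  then have "prob (ball z \<delta>) = 0" for z
    using prob_ball_upper[OF assms, of 0 z] measure_nonneg[of \<mu> "ball z \<delta>"] by simp
  then have null: "ball z \<delta> \<in> null_sets \<mu>" for z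
    by (auto simp: null_sets_def emeasure_eq_measure)
  obtain D :: "'a set" where D: "countable D" "\<And>X. open X \<Longrightarrow> X \<noteq> {} \<Longrightarrow> \<exists>d\<in>D. d \<in> X"
    using countable_dense_setE by blast
  have "(\<Union>d\<in>D. ball d \<delta>) \<in> null_sets \<mu>"
    using D(1) null by (intro null_sets_UN') auto
  moreover have "(\<Union>d\<in>D. ball d \<delta>) = UNIV"
    using D(2)[of "ball _ \<delta>"] assms by (auto simp: dist_commute)
  ultimately show False
    using emeasure_space_1 by (auto simp: null_sets_def)
qed

text \<open>The upper bound is tested with a vector of norm \<open>a\<close> along the tail of
  \<open>x\<close>, whose variance is at most \<open>a\<^sup>2 * q (v N)\<close>. The parameter
  \<open>a\<close> trades the two errors: large \<open>a\<close> suppresses the term with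
  \<open>ln c\<close>, then large \<open>N\<close> the term with \<open>q (v N)\<close>.\<close>

lemma tail_bound:
  assumes "c > 0" "\<delta> > 0" "a > 0" and ge: "c * prob (ball 0 \<delta>) \<le> prob (ball x \<delta>)"
  shows "norm (x - P N x) \<le> a * q (v N) / 2 + \<delta> + (- ln c) / a"
proof -
  have inner_le: "u \<bullet> x \<le> q u / 2 + norm u * \<delta> + (- ln c)" for u
  proof -
    have "exp (u \<bullet> x - norm u * \<delta>) * (c * prob (ball 0 \<delta>)) \<le> exp (q u / 2) * prob (ball 0 \<delta>)"
      using prob_ball_upper[OF assms(2), of u x] ge by (meson exp_ge_zero mult_left_mono order_trans)
    then have "exp (u \<bullet> x - norm u * \<delta>) * c \<le> exp (q u / 2)"
      using prob_ball_0_pos[OF assms(2)] by (simp add: mult.assoc[symmetric])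
    then have "exp (u \<bullet> x - norm u * \<delta> + ln c) \<le> exp (q u / 2)"
      using \<open>c > 0\<close> by (simp add: exp_add)
    then show ?thesis by simp
  qed
  define r where "r = x - P N x"
  define \<rho> where "\<rho> = norm r"
  show ?thesis
  proof (cases "\<rho> = 0")
    case True
    \<comment> \<open>Taking \<open>u = 0\<close> shows that \<open>c\<close> is at most 1.\<close>
    have "- ln c \<ge> 0" using inner_le[of 0] by simp
    then have "0 \<le> (- ln c) / a" using \<open>a > 0\<close> by (intro divide_nonneg_pos) auto
    moreover have "0 \<le> a * q (v N) / 2" using \<open>a > 0\<close> q_nonneg[of "v N"] by simp
    ultimately show ?thesis using True \<open>\<delta> > 0\<close> unfolding \<rho>_def r_def by linarith
  next
    case False
    then have \<rho>: "\<rho> > 0" by (simp add: \<rho>_def)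
    have orth: "v i \<bullet> r = 0" if "i < N" for i
      using that by (simp add: r_def inner_diff_right v_inner_P)
    have "r \<bullet> P N x = 0"
      unfolding P_def inner_sum_right by (intro sum.neutral) (simp add: orth inner_commute[of r])
    then have rx: "r \<bullet> x = \<rho>\<^sup>2"
      by (simp add: \<rho>_def r_def power2_norm_eq_inner inner_diff_right)
    have "(a / \<rho>) * \<rho>\<^sup>2 \<le> (a / \<rho>)\<^sup>2 * q r / 2 + (a / \<rho>) * \<rho> * \<delta> + (- ln c)"
      using inner_le[of "(a / \<rho>) *\<^sub>R r"] \<open>a > 0\<close> \<rho> by (simp add: q_scaleR rx \<rho>_def[symmetric])
    moreover have "(a / \<rho>)\<^sup>2 * q r \<le> (a / \<rho>)\<^sup>2 * (q (v N) * \<rho>\<^sup>2)"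
      using q_le_of_orth[OF orth, of N] by (intro mult_left_mono) (auto simp: \<rho>_def)
    moreover have "(a / \<rho>) * \<rho>\<^sup>2 = a * \<rho>" "(a / \<rho>)\<^sup>2 * (q (v N) * \<rho>\<^sup>2) = a\<^sup>2 * q (v N)" "(a / \<rho>) * \<rho> * \<delta> = a * \<delta>"
      using \<rho> by (auto simp: power2_eq_square field_simps)
    ultimately have "a * \<rho> \<le> a\<^sup>2 * q (v N) / 2 + a * \<delta> + (- ln c)" by argo
    then have "\<rho> \<le> (a\<^sup>2 * q (v N) / 2 + a * \<delta> + (- ln c)) / a"
      using \<open>a > 0\<close> by (simp add: field_simps)
    also have "\<dots> = a * q (v N) / 2 + \<delta> + (- ln c) / a"
      using \<open>a > 0\<close> by (simp add: field_simps power2_eq_square)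
    finally show ?thesis by (simp add: \<rho>_def r_def)
  qed
qed

text \<open>\<open>tail_bound\<close> first gives boundedness, hence a weakly convergent
  subsequence, and then uniformly small tails, which upgrade weak to strong convergence.\<close>

lemma convergent_subsequence_if_prob_ball_ge:
  fixes x :: "nat \<Rightarrow> 'a"
  assumes "c > 0" "\<And>n. \<delta> n > 0" "\<delta> \<longlonglongrightarrow> 0"
    and ge: "\<And>n. c * prob (ball 0 (\<delta> n)) \<le> prob (ball (x n) (\<delta> n))"
  obtains r w where "strict_mono r" "(\<lambda>n. x (r n)) \<longlonglongrightarrow> w"
proof -
  obtain d where d: "\<And>n. \<bar>\<delta> n\<bar> \<le> d"
    using convergent_imp_Bseq[OF convergentI[OF assms(3)]] by (auto simp: Bseq_def)
  \<comment> \<open>The bound of \<open>tail_bound\<close> for \<open>a = 1\<close> and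
    \<open>N = 0\<close>, where the projection is zero; the maximum with 1 makes division by
    \<open>R\<close> safe.\<close>
  define R where "R = max 1 (q (v 0) / 2 + d + (- ln c))"
  have R: "R \<ge> 1" by (simp add: R_def)
  have "norm (x n) \<le> R" for n
    using tail_bound[OF assms(1,2) zero_less_one ge, of n 0] d[of n] by (simp add: P_def R_def)
  then have "norm ((1 / R) *\<^sub>R x n) \<le> 1" for n
    using R by (simp add: divide_le_eq)
  then obtain r w where r: "strict_mono r" and w: "\<And>y. (\<lambda>n. ((1 / R) *\<^sub>R x (r n)) \<bullet> y) \<longlonglongrightarrow> w \<bullet> y"
    using weakly_convergent_subsequence[of "\<lambda>n. (1 / R) *\<^sub>R x n"] by metis
  have weak: "(\<lambda>n. y \<bullet> x (r n)) \<longlonglongrightarrow> y \<bullet> (R *\<^sub>R w)" for y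
    using tendsto_mult_left[OF w[of y], of R] R by (simp add: inner_commute)
  have "(\<lambda>n. x (r n)) \<longlonglongrightarrow> R *\<^sub>R w"
  proof (rule LIMSEQ_I)
    fix e :: real assume e: "e > 0"
    \<comment> \<open>Chosen to bring the term with \<open>ln c\<close> below \<open>e / 6\<close>.
      The error budget is three times \<open>e / 6\<close> for the tail of \<open>x (r n)\<close>
      and twice \<open>e / 4\<close> for the projections.\<close>
    define a where "a = 1 + 6 * \<bar>ln c\<bar> / e"
    have a: "a > 0" using e by (simp add: a_def add_pos_nonneg)
    have "(- ln c) / a < e / 6"
    proof -
      have "6 * (- ln c) \<le> 6 * \<bar>ln c\<bar>" by simp
      also have "\<dots> < e * a" using e by (simp add: a_def distrib_left)
      finally show ?thesis using a e by (simp add: field_simps)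
    qed
    have "(\<lambda>N. a * q (v N) / 2) \<longlonglongrightarrow> a * 0 / 2" by (intro tendsto_intros q_v_tendsto_0) auto
    from order_tendstoD(2)[OF this, of "e / 6"] have "eventually (\<lambda>N. a * q (v N) / 2 < e / 6) sequentially"
      using e by simp
    moreover have "eventually (\<lambda>N. dist (P N (R *\<^sub>R w)) (R *\<^sub>R w) < e / 4) sequentially"
      using e by (intro tendstoD[OF P_tendsto]) auto
    ultimately obtain N where N: "a * q (v N) / 2 < e / 6" "dist (P N (R *\<^sub>R w)) (R *\<^sub>R w) < e / 4"
      using eventually_happens[OF eventually_conj] by (metis (mono_tags, lifting) sequentially_bot)
    \<comment> \<open>A projection of finite rank turns weak into strong convergence.\<close>
    have "(\<lambda>n. P N (x (r n))) \<longlonglongrightarrow> P N (R *\<^sub>R w)"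
      unfolding P_def by (intro tendsto_intros weak)
    then have "eventually (\<lambda>n. dist (P N (x (r n))) (P N (R *\<^sub>R w)) < e / 4) sequentially"
      using e by (intro tendstoD) auto
    moreover have "eventually (\<lambda>n. \<delta> (r n) < e / 6) sequentially"
      using LIMSEQ_subseq_LIMSEQ[OF assms(3) r] e by (intro order_tendstoD) (auto simp: o_def)
    ultimately have "eventually (\<lambda>n. norm (x (r n) - R *\<^sub>R w) < e) sequentially"
    proof eventually_elim
      case (elim n)
      have "dist (x (r n)) (P N (x (r n))) \<le> a * q (v N) / 2 + \<delta> (r n) + (- ln c) / a"
        using tail_bound[OF assms(1,2) a ge, of "r n" N] by (simp add: dist_norm)
      with \<open>(- ln c) / a < e / 6\<close> N(1) elim(2) have "dist (x (r n)) (P N (x (r n))) < e / 2" by argo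
      moreover have "dist (x (r n)) (R *\<^sub>R w) \<le> dist (x (r n)) (P N (x (r n)))
          + dist (P N (x (r n))) (P N (R *\<^sub>R w)) + dist (P N (R *\<^sub>R w)) (R *\<^sub>R w)"
        by (metis (no_types) add.assoc add_left_mono dist_triangle order_trans)
      ultimately show ?case using N(2) elim(1) unfolding dist_norm[symmetric] by argo
    qed
    then show "\<exists>no. \<forall>n\<ge>no. norm (x (r n) - R *\<^sub>R w) < e" by (simp add: eventually_sequentially)
  qed
  with r show thesis by (rule that)
qed

end

section \<open>The posterior measure\<close>

locale gaussian_posterior = gaussian_hilbert_basis +
  fixes \<Phi> :: "'a \<Rightarrow> real"
  assumes admissible: "admissible_potential \<Phi>"
begin

abbreviation \<nu> :: "'a measure" where
  "\<nu> \<equiv> posterior \<mu> \<Phi>"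

definition Z :: real where
  "Z = expectation (\<lambda>u. exp (- \<Phi> u))"

definition dens :: "'a \<Rightarrow> real" where
  "dens u = inverse Z * exp (- \<Phi> u)"

text \<open>On the Cameron-Martin space this is the limiting ratio of the posterior mass of a small
  ball at \<open>u\<close> to the \<open>\<mu>\<close>-mass of the ball at \<open>0\<close>, and
  equals \<open>inverse Z * exp (- onsager_machlup \<mu> \<Phi> u)\<close>.\<close>

definition weight :: "'a \<Rightarrow> real" where
  "weight u = dens u * exp (- (cm_norm \<mu> u)\<^sup>2 / 2)"

lemma continuous_potential: "continuous_on UNIV \<Phi>"
proof (rule continuous_at_imp_continuous_on, safe)
  fix x :: 'a
  have "norm x + 1 > 0" by (simp add: add_nonneg_pos)
  then obtain L where L: "L > 0" "\<And>y z. norm y \<le> norm x + 1 \<Longrightarrow> norm z \<le> norm x + 1 \<Longrightarrow> \<bar>\<Phi> y - \<Phi> z\<bar> \<le> L * norm (y - z)"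
    using admissible unfolding admissible_potential_def by (metis (no_types))
  show "isCont \<Phi> x"
    unfolding continuous_at_eps_delta
  proof (intro allI impI)
    fix e :: real assume "e > 0"
    have "\<bar>\<Phi> y - \<Phi> x\<bar> < e" if "dist y x < min 1 (e / L)" for y
    proof -
      have "norm y \<le> norm x + 1"
        using that norm_triangle_ineq2[of y x] by (simp add: dist_norm)
      then have "\<bar>\<Phi> y - \<Phi> x\<bar> \<le> L * norm (y - x)" by (intro L) auto
      also have "\<dots> < e" using that L(1) by (simp add: dist_norm field_simps)
      finally show ?thesis .
    qed
    then show "\<exists>d>0. \<forall>y. dist y x < d \<longrightarrow> dist (\<Phi> y) (\<Phi> x) < e"
      using \<open>e > 0\<close> L(1) by (intro exI[of _ "min 1 (e / L)"]) (auto simp: dist_real_def)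
  qed
qed

lemma potential_measurable [measurable]: "\<Phi> \<in> borel_measurable borel"
  by (rule borel_measurable_continuous_onI[OF continuous_potential])

lemma integrable_exp_potential: "integrable \<mu> (\<lambda>u. exp (- \<Phi> u))"
proof -
  obtain m where "\<And>u. \<Phi> u \<ge> m" using admissible unfolding admissible_potential_def by blast
  then show ?thesis by (intro integrable_const_bound[where B = "exp (- m)"]) auto
qed

lemma Z_pos: "Z > 0"
proof -
  have "Z \<ge> 0" unfolding Z_def by (intro Bochner_Integration.integral_nonneg) simp
  moreover have "Z \<noteq> 0"
  proof
    assume "Z = 0"
    then have "AE u in \<mu>. exp (- \<Phi> u) = 0"
      unfolding Z_def using integral_nonneg_eq_0_iff_AE[OF integrable_exp_potential] by simp
    then show False by simp
  qed
  ultimately show ?thesis by simp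
qed

lemma dens_pos: "dens u > 0"
  using Z_pos by (simp add: dens_def)

lemma dens_measurable [measurable]: "dens \<in> borel_measurable borel"
  unfolding dens_def by measurable

lemma dens_bounded:
  obtains b where "b > 0" "\<And>u. dens u \<le> b"
proof -
  obtain m where "\<And>u. \<Phi> u \<ge> m" using admissible unfolding admissible_potential_def by blast
  then have "dens u \<le> inverse Z * exp (- m)" for u
    using Z_pos by (simp add: dens_def)
  moreover have "inverse Z * exp (- m) > 0" using Z_pos by simp
  ultimately show thesis by (rule that[rotated])
qed

lemma dens_near:
  assumes "a < dens z" "dens z < b"
  obtains d where "d > 0" "\<And>y. dist y z < d \<Longrightarrow> a < dens y \<and> dens y < b"
proof -
  have "continuous_on UNIV dens"
    unfolding dens_def by (intro continuous_intros continuous_potential)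
  then have "(dens \<longlongrightarrow> dens z) (nhds z)"
    by (simp add: continuous_on_eq_continuous_at continuous_at tendsto_at_iff_tendsto_nhds)
  then have "eventually (\<lambda>y. a < dens y \<and> dens y < b) (nhds z)"
    using assms by (intro eventually_conj order_tendstoD)
  then show thesis by (auto simp: eventually_nhds_metric intro: that)
qed

lemma posterior_eq: "\<nu> = density \<mu> (\<lambda>u. ennreal (dens u))"
  by (simp add: posterior_def dens_def Z_def)

lemma prob_space_posterior: "prob_space \<nu>"
proof (rule prob_spaceI)
  have "(\<integral>\<^sup>+u. ennreal (dens u) \<partial>\<mu>) = ennreal (expectation dens)"
    unfolding dens_def using Z_pos
    by (intro nn_integral_eq_integral integrable_mult_right integrable_exp_potential) auto
  also have "expectation dens = 1"
    using Z_pos by (simp add: dens_def[abs_def] Z_def[symmetric])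
  finally show "emeasure \<nu> (space \<nu>) = 1"
    unfolding posterior_eq by (simp add: emeasure_density)
qed

sublocale post: prob_space \<nu>
  by (rule prob_space_posterior)

lemma posterior_le:
  assumes "A \<in> sets borel" "\<And>x. x \<in> A \<Longrightarrow> dens x \<le> b" "b \<ge> 0"
  shows "measure \<nu> A \<le> b * prob A"
proof -
  have "ennreal (measure \<nu> A) = (\<integral>\<^sup>+x. ennreal (dens x) * indicator A x \<partial>\<mu>)"
    unfolding post.emeasure_eq_measure[symmetric] using assms(1)
    by (simp add: posterior_eq emeasure_density)
  also have "\<dots> \<le> (\<integral>\<^sup>+x. ennreal b * indicator A x \<partial>\<mu>)"
    using assms(2) by (intro nn_integral_mono) (auto simp: indicator_def intro: ennreal_leI)
  also have "\<dots> = ennreal (b * prob A)"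
    using assms(1,3) by (simp add: nn_integral_cmult emeasure_eq_measure ennreal_mult)
  finally show ?thesis using assms(3) by (simp add: ennreal_le_iff)
qed

lemma posterior_ge:
  assumes "A \<in> sets borel" "\<And>x. x \<in> A \<Longrightarrow> a \<le> dens x" "a \<ge> 0"
  shows "a * prob A \<le> measure \<nu> A"
proof -
  have "ennreal (a * prob A) = (\<integral>\<^sup>+x. ennreal a * indicator A x \<partial>\<mu>)"
    using assms(1,3) by (simp add: nn_integral_cmult emeasure_eq_measure ennreal_mult)
  also have "\<dots> \<le> (\<integral>\<^sup>+x. ennreal (dens x) * indicator A x \<partial>\<mu>)"
    using assms(2) by (intro nn_integral_mono) (auto simp: indicator_def intro: ennreal_leI)
  also have "\<dots> = ennreal (measure \<nu> A)"
    unfolding post.emeasure_eq_measure[symmetric] using assms(1)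
    by (simp add: posterior_eq emeasure_density)
  finally show ?thesis by (simp add: ennreal_le_iff)
qed

lemma weight_pos: "weight u > 0"
  by (simp add: weight_def dens_pos)

lemma weight_le_iff: "weight h \<le> weight z \<longleftrightarrow> onsager_machlup \<mu> \<Phi> z \<le> onsager_machlup \<mu> \<Phi> h"
proof -
  have "weight u = inverse Z * exp (- onsager_machlup \<mu> \<Phi> u)" for u
    by (simp add: weight_def dens_def onsager_machlup_def mult_exp_exp)
  then show ?thesis using Z_pos by simp
qed

text \<open>Upper half of the Onsager-Machlup limit, along moving centres. For fixed
  \<open>u\<close> the radius tends to 0 first; the resulting bound is uniform in \<open>u\<close>,
  so duality yields both the membership of \<open>z\<close> and the estimate.\<close>

lemma weight_ge_if_ball_ge:
  fixes x :: "nat \<Rightarrow> 'a"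
  assumes "\<And>n. \<delta> n > 0" "\<delta> \<longlonglongrightarrow> 0" "x \<longlonglongrightarrow> z" "c > 0"
    and ge: "eventually (\<lambda>n. c * prob (ball 0 (\<delta> n)) \<le> measure \<nu> (ball (x n) (\<delta> n))) sequentially"
  shows "z \<in> cm_space \<mu>" "c \<le> weight z"
proof -
  have "exp (u \<bullet> z) * c \<le> dens z * exp (q u / 2)" for u
  proof (rule field_le_epsilon)
    fix e :: real assume "e > 0"
    \<comment> \<open>The slack in \<open>dens\<close> is rescaled so that after multiplication by
      \<open>exp (q u / 2)\<close> it equals \<open>e\<close>.\<close>
    define e' where "e' = e / exp (q u / 2)"
    have e': "e' > 0" using \<open>e > 0\<close> by (simp add: e'_def)
    obtain d where d: "d > 0" "\<And>y. dist y z < d \<Longrightarrow> dens z - 1 < dens y \<and> dens y < dens z + e'"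
      \<comment> \<open>Only the upper bound on \<open>dens\<close> matters;
        \<open>dens z - 1\<close> merely fills the lower slot.\<close>
      by (rule dens_near[of "dens z - 1" z "dens z + e'"]) (use e' in auto)
    have "eventually (\<lambda>n. dist (x n) z < d / 2) sequentially" "eventually (\<lambda>n. \<delta> n < d / 2) sequentially"
      using tendstoD[OF assms(3), of "d / 2"] order_tendstoD(2)[OF assms(2), of "d / 2"] d(1) by auto
    then have "eventually (\<lambda>n. exp (u \<bullet> x n - norm u * \<delta> n) * c \<le> (dens z + e') * exp (q u / 2)) sequentially"
      using ge
    proof eventually_elim
      case (elim n)
      have "dens y \<le> dens z + e'" if "y \<in> ball (x n) (\<delta> n)" for y
      proof -
        have "dist y z \<le> dist (x n) y + dist (x n) z"
          using dist_triangle[of y z "x n"] by (simp add: dist_commute)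
        then have "dist y z < d" using that elim(1,2) by simp
        then show ?thesis using d(2) less_imp_le by blast
      qed
      then have "measure \<nu> (ball (x n) (\<delta> n)) \<le> (dens z + e') * prob (ball (x n) (\<delta> n))"
        using dens_pos[of z] e' by (intro posterior_le) auto
      with elim(3) have "c * prob (ball 0 (\<delta> n)) \<le> (dens z + e') * prob (ball (x n) (\<delta> n))" by simp
      then have "exp (u \<bullet> x n - norm u * \<delta> n) * (c * prob (ball 0 (\<delta> n)))
          \<le> (dens z + e') * (exp (u \<bullet> x n - norm u * \<delta> n) * prob (ball (x n) (\<delta> n)))"
        by (simp add: mult.left_commute)
      also have "\<dots> \<le> (dens z + e') * (exp (q u / 2) * prob (ball 0 (\<delta> n)))"
        using dens_pos[of z] e' by (intro mult_left_mono prob_ball_upper assms) auto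
      finally show ?case
        using prob_ball_0_pos[OF assms(1)[of n]] by (simp add: mult.assoc[symmetric])
    qed
    moreover have "(\<lambda>n. exp (u \<bullet> x n - norm u * \<delta> n) * c) \<longlonglongrightarrow> exp (u \<bullet> z - norm u * 0) * c"
      by (intro tendsto_intros assms)
    ultimately have "exp (u \<bullet> z - norm u * 0) * c \<le> (dens z + e') * exp (q u / 2)"
      by (intro tendsto_upperbound) auto
    then show "exp (u \<bullet> z) * c \<le> dens z * exp (q u / 2) + e"
      by (simp add: e'_def algebra_simps)
  qed
  then have "exp (u \<bullet> z - q u / 2) \<le> dens z / c" for u
    unfolding exp_diff using \<open>c > 0\<close> by (simp add: field_simps)
  then have "u \<bullet> z - q u / 2 \<le> ln (dens z / c)" for u
    using dens_pos[of z] \<open>c > 0\<close> by (simp add: ln_ge_iff)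
  from cm_space_and_norm_le[OF this]
  have "z \<in> cm_space \<mu>" "(cm_norm \<mu> z)\<^sup>2 / 2 \<le> ln (dens z / c)" by auto
  then have "exp ((cm_norm \<mu> z)\<^sup>2 / 2) \<le> dens z / c"
    using dens_pos[of z] \<open>c > 0\<close> by (subst ln_ge_iff[symmetric]) auto
  then show "c \<le> weight z"
    using \<open>c > 0\<close> by (simp add: weight_def exp_minus field_simps)
  show "z \<in> cm_space \<mu>" by fact
qed

text \<open>Lower half of the limit, at a fixed centre. The strict gap between \<open>c\<close> and
  \<open>weight h\<close> pays for the variation of \<open>dens\<close> on small balls.\<close>

lemma ball_ge_if_weight_greater:
  assumes "h \<in> cm_space \<mu>" "0 \<le> c" "c < weight h"
  shows "eventually (\<lambda>\<delta>. c * prob (ball 0 \<delta>) \<le> measure \<nu> (ball h \<delta>)) (at_right 0)"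
proof -
  let ?k = "exp (- (cm_norm \<mu> h)\<^sup>2 / 2)"
  have "c / ?k < dens h"
    using assms(3) by (simp add: weight_def pos_divide_less_eq)
  then obtain d where d: "d > 0" "\<And>y. dist y h < d \<Longrightarrow> c / ?k < dens y \<and> dens y < dens h + 1"
    by (rule dens_near[of "c / ?k" h "dens h + 1"]) auto
  have "c * prob (ball 0 \<delta>) \<le> measure \<nu> (ball h \<delta>)" if \<delta>: "0 < \<delta>" "\<delta> < d" for \<delta>
  proof -
    have "c * prob (ball 0 \<delta>) = c / ?k * (?k * prob (ball 0 \<delta>))" by simp
    also have "\<dots> \<le> c / ?k * prob (ball h \<delta>)"
      using assms(1,2) \<delta> by (intro mult_left_mono prob_ball_lower) auto
    also have "\<dots> \<le> measure \<nu> (ball h \<delta>)"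
      using assms(2) \<delta> d(2) by (intro posterior_ge) (auto simp: dist_commute intro!: less_imp_le)
    finally show ?thesis .
  qed
  then show ?thesis using d(1) unfolding eventually_at_right_field by blast
qed

lemma zero_in_cm_space: "0 \<in> cm_space \<mu>"
  by (rule cm_space_and_norm_le(1)[of _ 0]) (simp add: q_nonneg)

lemma ball_measure_pos:
  assumes "\<delta> > 0"
  shows "measure \<nu> (ball 0 \<delta>) > 0"
proof -
  obtain c where c: "0 < c" "c < weight 0" using dense weight_pos by blast
  then have "eventually (\<lambda>\<delta>. c * prob (ball 0 \<delta>) \<le> measure \<nu> (ball 0 \<delta>)) (at_right 0)"
    by (intro ball_ge_if_weight_greater zero_in_cm_space) auto
  then obtain b where b: "b > 0" "\<And>y. 0 < y \<Longrightarrow> y < b \<Longrightarrow> c * prob (ball 0 y) \<le> measure \<nu> (ball 0 y)"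
    unfolding eventually_at_right_field by blast
  \<comment> \<open>The estimate holds only for small radii; monotonicity carries positivity to
    every \<open>\<delta>\<close>.\<close>
  define y where "y = min (b / 2) \<delta>"
  have y: "0 < y" "y < b" "y \<le> \<delta>" using b(1) assms by (auto simp: y_def min_less_iff_disj)
  have "0 < c * prob (ball 0 y)" using c(1) prob_ball_0_pos[OF y(1)] by simp
  also have "\<dots> \<le> measure \<nu> (ball 0 y)" by (rule b(2)[OF y(1,2)])
  also have "\<dots> \<le> measure \<nu> (ball 0 \<delta>)"
    using y(3) by (intro post.finite_measure_mono) (auto simp: posterior_eq)
  finally show ?thesis .
qed

section \<open>Ball ratios and near-maximising centres\<close>

definition S :: "real \<Rightarrow> real" where
  "S \<delta> = (SUP x. measure \<nu> (ball x \<delta>))"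

lemma ball_bdd: "bdd_above (range (\<lambda>x. measure \<nu> (ball x \<delta>)))"
  by (rule bdd_aboveI2[where M = 1]) simp

lemma ball_le_S: "measure \<nu> (ball x \<delta>) \<le> S \<delta>"
  unfolding S_def by (rule cSUP_upper[OF UNIV_I ball_bdd])

lemma S_pos: "\<delta> > 0 \<Longrightarrow> S \<delta> > 0"
  using ball_measure_pos ball_le_S by (rule less_le_trans)

lemma ball_ratio_eq: "ball_ratio \<nu> \<delta> x = measure \<nu> (ball x \<delta>) / S \<delta>"
  by (simp add: ball_ratio_def S_def)

lemma ball_ratio_le_1: "\<delta> > 0 \<Longrightarrow> ball_ratio \<nu> \<delta> x \<le> 1"
  using S_pos ball_le_S by (simp add: ball_ratio_eq divide_le_eq)

lemma ball_ratio_ge_iff: "\<delta> > 0 \<Longrightarrow> a \<le> ball_ratio \<nu> \<delta> x \<longleftrightarrow> a * S \<delta> \<le> measure \<nu> (ball x \<delta>)"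
  using S_pos by (simp add: ball_ratio_eq pos_le_divide_eq)

lemma near_maximiser_exists:
  assumes "\<delta> > 0" "\<eta> > 0"
  shows "\<exists>x. 1 - \<eta> \<le> ball_ratio \<nu> \<delta> x"
proof -
  have "(1 - \<eta>) * S \<delta> < S \<delta>" using assms S_pos[OF assms(1)] by simp
  then obtain x where "(1 - \<eta>) * S \<delta> < measure \<nu> (ball x \<delta>)"
    unfolding S_def using less_cSUP_iff[OF UNIV_not_empty ball_bdd, of "(1 - \<eta>) * S \<delta>" \<delta>]
    by (auto simp: S_def)
  then show ?thesis using assms by (auto simp: ball_ratio_ge_iff intro: less_imp_le)
qed

text \<open>The balls at \<open>x n\<close> nearly dominate the ball at any fixed \<open>h\<close>.
  The lower half of the limit at \<open>h\<close> and the upper half along \<open>x\<close> then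
  give \<open>c \<le> weight z\<close> for every positive \<open>c\<close> below
  \<open>weight h\<close>.\<close>

lemma limit_maximises_weight:
  assumes \<delta>: "\<And>n. \<delta> n > 0" "\<delta> \<longlonglongrightarrow> 0" and x: "x \<longlonglongrightarrow> z" and \<eta>: "\<eta> \<longlonglongrightarrow> 0"
    and ratio: "\<And>n. 1 - \<eta> n \<le> ball_ratio \<nu> (\<delta> n) (x n)"
  shows "z \<in> cm_space \<mu>" "\<And>h. h \<in> cm_space \<mu> \<Longrightarrow> weight h \<le> weight z"
proof -
  have \<delta>_right: "filterlim \<delta> (at_right 0) sequentially"
    using \<delta> by (intro tendsto_imp_filterlim_at_right) auto
  have main: "z \<in> cm_space \<mu> \<and> c \<le> weight z" if h: "h \<in> cm_space \<mu>" and c: "0 < c" "c < weight h" for h c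
  proof -
    \<comment> \<open>The gap between \<open>c\<close> and \<open>c'\<close> absorbs the loss
      \<open>1 - \<eta> n\<close>, which eventually exceeds \<open>c / c'\<close>.\<close>
    obtain c' where c': "c < c'" "c' < weight h" using dense c(2) by blast
    have "eventually (\<lambda>n. c' * prob (ball 0 (\<delta> n)) \<le> measure \<nu> (ball h (\<delta> n))) sequentially"
      using ball_ge_if_weight_greater[OF h, of c'] c c' \<delta>_right
      by (auto simp: filterlim_iff)
    moreover have "eventually (\<lambda>n. \<eta> n < 1 - c / c') sequentially"
      using \<eta> c c' by (intro order_tendstoD(2)[OF \<eta>]) auto
    ultimately have "eventually (\<lambda>n. c * prob (ball 0 (\<delta> n)) \<le> measure \<nu> (ball (x n) (\<delta> n))) sequentially"
    proof eventually_elim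
      case (elim n)
      have "c * prob (ball 0 (\<delta> n)) = c / c' * (c' * prob (ball 0 (\<delta> n)))" using c c' by simp
      also have "\<dots> \<le> c / c' * measure \<nu> (ball h (\<delta> n))"
        using elim(1) c c' by (intro mult_left_mono) auto
      also have "\<dots> \<le> (1 - \<eta> n) * S (\<delta> n)"
      proof (intro mult_mono ball_le_S)
        have "0 < c / c'" using c c' by simp
        with elim(2) show "c / c' \<le> 1 - \<eta> n" "0 \<le> 1 - \<eta> n" by linarith+
      qed simp
      also have "\<dots> \<le> measure \<nu> (ball (x n) (\<delta> n))"
        using ratio[of n] \<delta>(1)[of n] by (simp add: ball_ratio_ge_iff)
      finally show ?case .
    qed
    from weight_ge_if_ball_ge[OF \<delta> x c(1) this] show ?thesis by simp
  qed
  obtain c where "0 < c" "c < weight 0" using dense weight_pos by blast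
  with main zero_in_cm_space show "z \<in> cm_space \<mu>" by blast
  show "weight h \<le> weight z" if "h \<in> cm_space \<mu>" for h
    by (rule dense_le_bounded[OF weight_pos[of h]]) (use main that in blast)
qed

text \<open>A near-maximising ball has at least half the posterior mass of the ball at
  \<open>0\<close>. Since \<open>dens\<close> is bounded above by \<open>b\<close>, this becomes a
  comparison of \<open>\<mu>\<close>-masses with constant \<open>c / (2 * b)\<close>, valid after
  finitely many terms are dropped.\<close>

lemma maximising_sequence_compact:
  assumes \<delta>: "\<And>n. \<delta> n > 0" "\<delta> \<longlonglongrightarrow> 0"
    and ratio: "\<And>n. 1 / 2 \<le> ball_ratio \<nu> (\<delta> n) (x n)"
  obtains r w where "strict_mono r" "(\<lambda>n. x (r n)) \<longlonglongrightarrow> w"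
proof -
  have \<delta>_right: "filterlim \<delta> (at_right 0) sequentially"
    using \<delta> by (intro tendsto_imp_filterlim_at_right) auto
  obtain c where c: "0 < c" "c < weight 0" using dense weight_pos by blast
  obtain b where b: "b > 0" "\<And>u. dens u \<le> b" using dens_bounded by blast
  have "eventually (\<lambda>n. c * prob (ball 0 (\<delta> n)) \<le> measure \<nu> (ball 0 (\<delta> n))) sequentially"
    using ball_ge_if_weight_greater[OF zero_in_cm_space, of c] c \<delta>_right by (auto simp: filterlim_iff)
  then obtain N where N: "\<And>n. n \<ge> N \<Longrightarrow> c * prob (ball 0 (\<delta> n)) \<le> measure \<nu> (ball 0 (\<delta> n))"
    by (auto simp: eventually_sequentially)
  have "c / (2 * b) * prob (ball 0 (\<delta> (n + N))) \<le> prob (ball (x (n + N)) (\<delta> (n + N)))" for n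
  proof -
    let ?n = "n + N"
    have "c * prob (ball 0 (\<delta> ?n)) \<le> S (\<delta> ?n)" using N[of ?n] ball_le_S[of 0 "\<delta> ?n"] by simp
    also have "S (\<delta> ?n) \<le> 2 * measure \<nu> (ball (x ?n) (\<delta> ?n))"
      using ratio[of ?n] ball_ratio_ge_iff[OF \<delta>(1)[of ?n], of "1 / 2" "x ?n"] by simp
    also have "measure \<nu> (ball (x ?n) (\<delta> ?n)) \<le> b * prob (ball (x ?n) (\<delta> ?n))"
      using b by (intro posterior_le) auto
    finally show ?thesis using b(1) by (simp add: field_simps)
  qed
  moreover have "(\<lambda>n. \<delta> (n + N)) \<longlonglongrightarrow> 0" using \<delta>(2) by (rule LIMSEQ_ignore_initial_segment)
  moreover have "c / (2 * b) > 0" using c b by simp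
  ultimately obtain r w where rw: "strict_mono r" "(\<lambda>n. x (r n + N)) \<longlonglongrightarrow> w"
    using convergent_subsequence_if_prob_ball_ge[of "c / (2 * b)" "\<lambda>n. \<delta> (n + N)" "\<lambda>n. x (n + N)"] \<delta>(1)
    by blast
  have "strict_mono (\<lambda>n. r n + N)" using rw(1) by (simp add: strict_mono_def)
  with rw(2) show thesis by (rule that[rotated])
qed

lemma near_maximising_limit:
  assumes \<delta>: "\<And>n. \<delta> n > 0" "\<delta> \<longlonglongrightarrow> 0"
  obtains x r w where "strict_mono r" "(\<lambda>n. x (r n)) \<longlonglongrightarrow> w" "w \<in> cm_space \<mu>"
    "\<And>h. h \<in> cm_space \<mu> \<Longrightarrow> weight h \<le> weight w"
    "\<And>n. 1 - 1 / real (n + 2) \<le> ball_ratio \<nu> (\<delta> n) (x n)"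
proof -
  \<comment> \<open>The offset 2 keeps every ratio at least \<open>1 / 2\<close>, including
    \<open>n = 0\<close>.\<close>
  have "\<exists>x. 1 - 1 / real (n + 2) \<le> ball_ratio \<nu> (\<delta> n) x" for n
    by (intro near_maximiser_exists \<delta>) simp
  then obtain x where x: "\<And>n. 1 - 1 / real (n + 2) \<le> ball_ratio \<nu> (\<delta> n) (x n)" by metis
  have "1 / 2 \<le> ball_ratio \<nu> (\<delta> n) (x n)" for n
  proof -
    have "1 / real (n + 2) \<le> 1 / 2" by (simp add: field_simps)
    with x[of n] show ?thesis by linarith
  qed
  then obtain r w where rw: "strict_mono r" "(\<lambda>n. x (r n)) \<longlonglongrightarrow> w"
    using maximising_sequence_compact[OF \<delta>] by metis
  have "(\<lambda>n. 1 / real (n + 2)) \<longlonglongrightarrow> 0"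
    using LIMSEQ_ignore_initial_segment[OF lim_1_over_n, of 2] by simp
  then have "(\<lambda>n. 1 / real (r n + 2)) \<longlonglongrightarrow> 0" "(\<lambda>n. \<delta> (r n)) \<longlonglongrightarrow> 0"
    using LIMSEQ_subseq_LIMSEQ[OF _ rw(1)] \<delta>(2) by (auto simp: o_def)
  note lim = limit_maximises_weight[of "\<lambda>n. \<delta> (r n)" "\<lambda>n. x (r n)" w "\<lambda>n. 1 / real (r n + 2)", OF \<delta>(1) this(2) rw(2) this(1) x]
  show thesis by (rule that[OF rw lim x])
qed

section \<open>Existence of a minimiser and the implications between the three notions\<close>

lemma maximiser_exists: "\<exists>z. z \<in> cm_space \<mu> \<and> (\<forall>h\<in>cm_space \<mu>. weight h \<le> weight z)"
proof -
  have "(\<lambda>n. 1 / real (Suc n)) \<longlonglongrightarrow> 0" by (intro LIMSEQ_Suc lim_1_over_n)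
  then show ?thesis
    using near_maximising_limit[of "\<lambda>n. 1 / real (Suc n)"] by (metis of_nat_0_less_iff zero_less_Suc zero_less_divide_1_iff)
qed

text \<open>If the ratio at \<open>z\<close> stayed below \<open>1 - e\<close> along radii tending
  to 0, near-maximising balls at those radii would outweigh the balls at \<open>z\<close> by a fixed
  factor \<open>k > 1\<close>. A limit of their centres would then have larger weight than
  \<open>z\<close>.\<close>

lemma MAP_estimator_if_maximiser:
  assumes z: "z \<in> cm_space \<mu>" and max: "\<And>h. h \<in> cm_space \<mu> \<Longrightarrow> weight h \<le> weight z"
  shows "MAP_estimator \<nu> z"
  unfolding MAP_estimator_def
proof (rule tendstoI, rule ccontr)
  fix e0 :: real assume "e0 > 0"
    and nev: "\<not> eventually (\<lambda>\<delta>. dist (ball_ratio \<nu> \<delta> z) 1 < e0) (at_right 0)"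
  \<comment> \<open>At most \<open>1 / 2\<close>, so that the denominator \<open>1 - e\<close> of
    \<open>k\<close> is positive.\<close>
  define e where "e = min e0 (1 / 2)"
  have e: "0 < e" "e \<le> 1 / 2" "e \<le> e0" using \<open>e0 > 0\<close> by (auto simp: e_def)
  have "\<exists>\<delta>>0. \<delta> < 1 / real (Suc n) \<and> ball_ratio \<nu> \<delta> z \<le> 1 - e" for n
  proof -
    obtain \<delta> where \<delta>: "0 < \<delta>" "\<delta> < 1 / real (Suc n)" "\<not> dist (ball_ratio \<nu> \<delta> z) 1 < e0"
      using nev unfolding eventually_at_right_field by (metis of_nat_0_less_iff zero_less_Suc zero_less_divide_1_iff)
    then have "ball_ratio \<nu> \<delta> z \<le> 1 - e0"
      using ball_ratio_le_1[of \<delta> z] by (simp add: dist_real_def)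
    with \<delta> e show ?thesis by force
  qed
  then obtain \<delta> where \<delta>: "\<And>n. \<delta> n > 0" "\<And>n. \<delta> n < 1 / real (Suc n)"
    and z_ratio: "\<And>n. ball_ratio \<nu> (\<delta> n) z \<le> 1 - e" by metis
  have \<delta>_lim: "\<delta> \<longlonglongrightarrow> 0"
    by (rule tendsto_sandwich[of "\<lambda>_. 0" _ _ "\<lambda>n. 1 / real (Suc n)"])
      (use \<delta> less_imp_le in \<open>auto intro!: always_eventually LIMSEQ_Suc lim_1_over_n simp del: of_nat_Suc\<close>)
  obtain x r w where r: "strict_mono r" and xw: "(\<lambda>n. x (r n)) \<longlonglongrightarrow> w" and w: "w \<in> cm_space \<mu>"
    and x: "\<And>n. 1 - 1 / real (n + 2) \<le> ball_ratio \<nu> (\<delta> n) (x n)"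
    using near_maximising_limit[OF \<delta>(1) \<delta>_lim] by metis
  have \<delta>r_lim: "(\<lambda>n. \<delta> (r n)) \<longlonglongrightarrow> 0" using LIMSEQ_subseq_LIMSEQ[OF \<delta>_lim r] by (simp add: o_def)
  then have \<delta>_right: "filterlim (\<lambda>n. \<delta> (r n)) (at_right 0) sequentially"
    using \<delta>(1) by (intro tendsto_imp_filterlim_at_right) auto
  \<comment> \<open>Near-maximisers eventually reach \<open>1 - e / 2\<close>, while
    \<open>z\<close> reaches at most \<open>1 - e\<close>.\<close>
  define k where "k = (1 - e / 2) / (1 - e)"
  have k: "k > 1" using e by (simp add: k_def)
  \<comment> \<open>The lower half of the limit needs a constant strictly below
    \<open>weight z\<close>; \<open>t < 1\<close> provides it, and \<open>k * t > 1\<close>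
    preserves the contradiction.\<close>
  then obtain t where t: "1 / k < t" "t < 1" using dense[of "1 / k" 1] by auto
  have t_pos: "t > 0" using t(1) k by (meson less_trans zero_less_divide_1_iff zero_less_one)
  define c where "c = t * weight z"
  have c: "0 < c" "c < weight z" using t t_pos weight_pos[of z] by (auto simp: c_def)
  have "eventually (\<lambda>n. c * prob (ball 0 (\<delta> (r n))) \<le> measure \<nu> (ball z (\<delta> (r n)))) sequentially"
    using ball_ge_if_weight_greater[OF z, of c] c \<delta>_right by (auto simp: filterlim_iff)
  moreover have "eventually (\<lambda>n. 1 / real (r n + 2) < e / 2) sequentially"
  proof -
    have "(\<lambda>n. 1 / real (n + 2)) \<longlonglongrightarrow> 0"
      using LIMSEQ_ignore_initial_segment[OF lim_1_over_n, of 2] by simp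
    from LIMSEQ_subseq_LIMSEQ[OF this r] show ?thesis
      using e by (intro order_tendstoD) (auto simp: o_def)
  qed
  ultimately have "eventually (\<lambda>n. k * c * prob (ball 0 (\<delta> (r n))) \<le> measure \<nu> (ball (x (r n)) (\<delta> (r n)))) sequentially"
  proof eventually_elim
    case (elim n)
    have "c * prob (ball 0 (\<delta> (r n))) \<le> (1 - e) * S (\<delta> (r n))"
      using elim(1) z_ratio[of "r n"] S_pos[OF \<delta>(1)[of "r n"]]
      by (simp add: ball_ratio_eq pos_divide_le_eq)
    then have "k * (c * prob (ball 0 (\<delta> (r n)))) \<le> k * ((1 - e) * S (\<delta> (r n)))"
      using k by (intro mult_left_mono) auto
    also have "\<dots> = (1 - e / 2) * S (\<delta> (r n))" using e by (simp add: k_def)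
    also have "\<dots> \<le> (1 - 1 / real (r n + 2)) * S (\<delta> (r n))"
      using elim(2) S_pos[OF \<delta>(1)[of "r n"]] by (intro mult_right_mono) auto
    also have "\<dots> \<le> measure \<nu> (ball (x (r n)) (\<delta> (r n)))"
      using x[of "r n"] ball_ratio_ge_iff[OF \<delta>(1)] by blast
    finally show ?case by (simp add: mult.assoc)
  qed
  moreover have "k * c > 0" using k c by simp
  ultimately have "k * c \<le> weight w"
    using weight_ge_if_ball_ge(2)[of "\<lambda>n. \<delta> (r n)" "\<lambda>n. x (r n)" w "k * c"] \<delta>(1) \<delta>r_lim xw by blast
  then have "(k * t) * weight z \<le> 1 * weight z" using max[OF w] by (simp add: c_def mult.assoc)
  then have "k * t \<le> 1" using weight_pos[of z] by (simp only: mult_le_cancel_right_pos)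
  moreover have "k * t > 1" using t(1) k by (simp add: field_simps)
  ultimately show False by simp
qed

text \<open>The constant family works. Since the error must lie in \<open>(0, 1)\<close> at every
  radius, the ratio must be positive at large radii too, which follows from small radii by
  monotonicity.\<close>

lemma MAP_estimator_imp_limit_point:
  assumes "MAP_estimator \<nu> z"
  shows "asymptotic_maximizing_family \<nu> (\<lambda>_. z)" "strong_limit_point (\<lambda>_. z) z"
proof -
  have lim: "((\<lambda>\<delta>. ball_ratio \<nu> \<delta> z) \<longlongrightarrow> 1) (at_right 0)"
    using assms by (simp add: MAP_estimator_def)
  have pos: "ball_ratio \<nu> \<delta> z > 0" if "\<delta> > 0" for \<delta>
  proof -
    have "eventually (\<lambda>\<delta>. ball_ratio \<nu> \<delta> z > 0) (at_right 0)"
      using lim by (rule order_tendstoD) simp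
    then obtain b where b: "b > 0" "\<And>y. 0 < y \<Longrightarrow> y < b \<Longrightarrow> ball_ratio \<nu> y z > 0"
      unfolding eventually_at_right_field by blast
    define y where "y = min (b / 2) \<delta>"
    have y: "0 < y" "y < b" "y \<le> \<delta>" using b(1) that by (auto simp: y_def min_less_iff_disj)
    have "0 < measure \<nu> (ball z y)"
      using b(2)[OF y(1,2)] S_pos[OF y(1)] by (simp add: ball_ratio_eq zero_less_divide_iff)
    also have "\<dots> \<le> measure \<nu> (ball z \<delta>)"
      using y(3) by (intro post.finite_measure_mono) (auto simp: posterior_eq)
    finally show ?thesis using S_pos[OF that] by (simp add: ball_ratio_eq)
  qed
  \<comment> \<open>The extra factor lies strictly between 0 and 1 and tends to 1; it makes the
    inequalities strict even where the ratio equals 1.\<close>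
  define \<epsilon> where "\<epsilon> \<delta> = 1 - ball_ratio \<nu> \<delta> z * (1 - min \<delta> (1 / 2))" for \<delta>
  have "0 < \<epsilon> \<delta> \<and> \<epsilon> \<delta> < 1 \<and> ball_ratio \<nu> \<delta> z > 1 - \<epsilon> \<delta>" if "\<delta> > 0" for \<delta>
  proof -
    have m: "0 < 1 - min \<delta> (1 / 2)" "1 - min \<delta> (1 / 2) < 1" using that by auto
    have "ball_ratio \<nu> \<delta> z * (1 - min \<delta> (1 / 2)) < ball_ratio \<nu> \<delta> z * 1"
      using pos[OF that] m by (intro mult_strict_left_mono) auto
    moreover have "0 < ball_ratio \<nu> \<delta> z * (1 - min \<delta> (1 / 2))" using pos[OF that] m by simp
    ultimately show ?thesis using ball_ratio_le_1[OF that, of z] by (simp add: \<epsilon>_def)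
  qed
  moreover have "(\<epsilon> \<longlongrightarrow> 1 - 1 * (1 - min 0 (1 / 2))) (at_right 0)"
    unfolding \<epsilon>_def by (intro tendsto_intros lim)
  ultimately show "asymptotic_maximizing_family \<nu> (\<lambda>_. z)"
    unfolding asymptotic_maximizing_family_def by (intro exI[of _ \<epsilon>]) auto
  have "decseq (\<lambda>n. 1 / real (Suc n))" by (rule decseq_SucI) (simp add: field_simps)
  moreover have "(\<lambda>n. 1 / real (Suc n)) \<longlonglongrightarrow> 0" by (intro LIMSEQ_Suc lim_1_over_n)
  ultimately show "strong_limit_point (\<lambda>_. z) z"
    unfolding strong_limit_point_def by (intro exI[of _ "\<lambda>n. 1 / real (Suc n)"]) auto
qed

lemma limit_point_maximises_weight:
  assumes "asymptotic_maximizing_family \<nu> \<zeta>" "strong_limit_point \<zeta> z"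
  shows "z \<in> cm_space \<mu>" "\<And>h. h \<in> cm_space \<mu> \<Longrightarrow> weight h \<le> weight z"
proof -
  obtain \<epsilon> where \<epsilon>: "(\<epsilon> \<longlongrightarrow> 0) (at_right 0)" "\<And>\<delta>. \<delta> > 0 \<Longrightarrow> ball_ratio \<nu> \<delta> (\<zeta> \<delta>) > 1 - \<epsilon> \<delta>"
    using assms(1) unfolding asymptotic_maximizing_family_def by blast
  obtain d where d: "\<And>n. d n > 0" "d \<longlonglongrightarrow> 0" "(\<lambda>n. norm (\<zeta> (d n) - z)) \<longlonglongrightarrow> 0"
    using assms(2) unfolding strong_limit_point_def by blast
  have "filterlim d (at_right 0) sequentially" using d by (intro tendsto_imp_filterlim_at_right) auto
  then have "(\<lambda>n. \<epsilon> (d n)) \<longlonglongrightarrow> 0" by (rule filterlim_compose[OF \<epsilon>(1)])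
  moreover have "(\<lambda>n. \<zeta> (d n)) \<longlonglongrightarrow> z"
    using d(3) by (simp add: tendsto_norm_zero_iff LIM_zero_iff)
  ultimately show "z \<in> cm_space \<mu>" "\<And>h. h \<in> cm_space \<mu> \<Longrightarrow> weight h \<le> weight z"
    using limit_maximises_weight[of d "\<lambda>n. \<zeta> (d n)" z "\<lambda>n. \<epsilon> (d n)"] d(1,2) \<epsilon>(2) less_imp_le by blast+
qed

end

theorem theorem2p4:
  fixes \<mu> :: "'a::{real_inner, polish_space} measure" and \<Phi> :: "'a \<Rightarrow> real"
  assumes "centred_gaussian_measure \<mu>" and "nondegenerate \<mu>"
    and "admissible_potential \<Phi>"
  shows "(\<forall>z.
      ((\<exists>\<zeta>. asymptotic_maximizing_family (posterior \<mu> \<Phi>) \<zeta> \<and> strong_limit_point \<zeta> z) \<longleftrightarrow>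
        (z \<in> cm_space \<mu> \<and> (\<forall>u\<in>cm_space \<mu>. onsager_machlup \<mu> \<Phi> z \<le> onsager_machlup \<mu> \<Phi> u))) \<and>
      ((z \<in> cm_space \<mu> \<and> (\<forall>u\<in>cm_space \<mu>. onsager_machlup \<mu> \<Phi> z \<le> onsager_machlup \<mu> \<Phi> u)) \<longleftrightarrow>
        MAP_estimator (posterior \<mu> \<Phi>) z)) \<and>
    (\<exists>z. MAP_estimator (posterior \<mu> \<Phi>) z)"
proof -
  interpret gaussian_hilbert \<mu> using assms by unfold_locales
  obtain v where "gaussian_hilbert_basis \<mu> v" by (rule gaussian_hilbert_basis_exists)
  then interpret gaussian_hilbert_basis \<mu> v .
  interpret gaussian_posterior \<mu> v \<Phi> using assms by unfold_locales
  have i_ii: "z \<in> cm_space \<mu> \<and> (\<forall>u\<in>cm_space \<mu>. weight u \<le> weight z)"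
    if "\<exists>\<zeta>. asymptotic_maximizing_family \<nu> \<zeta> \<and> strong_limit_point \<zeta> z" for z
    using that limit_point_maximises_weight by blast
  have ii_iii: "MAP_estimator \<nu> z"
    if "z \<in> cm_space \<mu> \<and> (\<forall>u\<in>cm_space \<mu>. weight u \<le> weight z)" for z
    using that MAP_estimator_if_maximiser by blast
  have iii_i: "\<exists>\<zeta>. asymptotic_maximizing_family \<nu> \<zeta> \<and> strong_limit_point \<zeta> z"
    if "MAP_estimator \<nu> z" for z
    using MAP_estimator_imp_limit_point[OF that] by blast
  have "\<exists>z. MAP_estimator \<nu> z" using maximiser_exists ii_iii by blast
  then show ?thesis
    unfolding weight_le_iff[symmetric] using i_ii ii_iii iii_i by blast
qed

end
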